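(* Let $X$ be a set, i.e. for all $x,y:X$ and $p,q:x=y$ we have $p=q$. Let $f:X\to X$ and $I:\prod_{x:X}(f(f(x))=f(x))$. Then $f$ has a splitting. That is, there exist a type $A$, maps $r:X\to A$ and $s:A\to X$, and homotopies $H:\prod_{a:A}(r(s(a))=a)$ and $K:\prod_{x:X}(s(r(x))=f(x))$.
   Context: Intensional Martin-Löf type theory; no extensionality axioms are assumed. *)

theory Defs
  imports Main
begin

text \<open>
  Intensional Martin-Loef type theory as a formal system: \<open>\<Pi>\<close>-types, \<open>\<Sigma>\<close>-types, coproducts, the
  empty type, the unit type, natural numbers, identity types, and a cumulative hierarchy of Russell
  universes. Neither equality reflection nor any axiom (function extensionality, univalence, K) is
  present.

  Terms are raw, in de Bruijn notation. An argument that binds \<open>k\<close> variables lives in a context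
  extended by \<open>k\<close> entries, the last bound variable having index 0:
  \<open>B\<close> in \<open>Pi A B\<close>, \<open>Sig A B\<close> and \<open>b\<close> in \<open>Lam A b\<close> bind one; in \<open>SigInd C g p\<close>, \<open>C\<close> binds one and \<open>g\<close>
  two; in \<open>CoprodInd C c d e\<close> each of \<open>C\<close>, \<open>c\<close>, \<open>d\<close> binds one; in \<open>EmptyInd C a\<close> and \<open>UnitInd C c a\<close>,
  \<open>C\<close> binds one; in \<open>NatInd C c d n\<close>, \<open>C\<close> binds one and \<open>d\<close> two (predecessor, then recursive value); in
  \<open>IdInd C c a b p\<close>, \<open>C\<close> binds three (two endpoints, then the path) and \<open>c\<close> one.
\<close>

datatype tm =
    Var nat
  | Univ nat
  | Pi tm tm
  | Lam tm tm
  | App tm tm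
  | Sig tm tm
  | Pr tm tm
  | SigInd tm tm tm
  | Coprod tm tm
  | InL tm
  | InR tm
  | CoprodInd tm tm tm tm
  | EmptyT
  | EmptyInd tm tm
  | UnitT
  | Star
  | UnitInd tm tm tm
  | NatT
  | Zero
  | Succ tm
  | NatInd tm tm tm tm
  | IdT tm tm tm
  | Refl tm
  | IdInd tm tm tm tm tm

definition up_ren :: "(nat \<Rightarrow> nat) \<Rightarrow> nat \<Rightarrow> nat" where
  "up_ren \<rho> = case_nat 0 (\<lambda>n. Suc (\<rho> n))"

primrec ren :: "(nat \<Rightarrow> nat) \<Rightarrow> tm \<Rightarrow> tm" where
  "ren \<rho> (Var n) = Var (\<rho> n)"
| "ren \<rho> (Univ i) = Univ i"
| "ren \<rho> (Pi A B) = Pi (ren \<rho> A) (ren (up_ren \<rho>) B)"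
| "ren \<rho> (Lam A b) = Lam (ren \<rho> A) (ren (up_ren \<rho>) b)"
| "ren \<rho> (App f a) = App (ren \<rho> f) (ren \<rho> a)"
| "ren \<rho> (Sig A B) = Sig (ren \<rho> A) (ren (up_ren \<rho>) B)"
| "ren \<rho> (Pr a b) = Pr (ren \<rho> a) (ren \<rho> b)"
| "ren \<rho> (SigInd C g p) = SigInd (ren (up_ren \<rho>) C) (ren (up_ren (up_ren \<rho>)) g) (ren \<rho> p)"
| "ren \<rho> (Coprod A B) = Coprod (ren \<rho> A) (ren \<rho> B)"
| "ren \<rho> (InL a) = InL (ren \<rho> a)"
| "ren \<rho> (InR b) = InR (ren \<rho> b)"
| "ren \<rho> (CoprodInd C c d e) =
     CoprodInd (ren (up_ren \<rho>) C) (ren (up_ren \<rho>) c) (ren (up_ren \<rho>) d) (ren \<rho> e)"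
| "ren \<rho> EmptyT = EmptyT"
| "ren \<rho> (EmptyInd C a) = EmptyInd (ren (up_ren \<rho>) C) (ren \<rho> a)"
| "ren \<rho> UnitT = UnitT"
| "ren \<rho> Star = Star"
| "ren \<rho> (UnitInd C c a) = UnitInd (ren (up_ren \<rho>) C) (ren \<rho> c) (ren \<rho> a)"
| "ren \<rho> NatT = NatT"
| "ren \<rho> Zero = Zero"
| "ren \<rho> (Succ n) = Succ (ren \<rho> n)"
| "ren \<rho> (NatInd C c d n) =
     NatInd (ren (up_ren \<rho>) C) (ren \<rho> c) (ren (up_ren (up_ren \<rho>)) d) (ren \<rho> n)"
| "ren \<rho> (IdT A a b) = IdT (ren \<rho> A) (ren \<rho> a) (ren \<rho> b)"
| "ren \<rho> (Refl a) = Refl (ren \<rho> a)"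
| "ren \<rho> (IdInd C c a b p) =
     IdInd (ren (up_ren (up_ren (up_ren \<rho>))) C) (ren (up_ren \<rho>) c) (ren \<rho> a) (ren \<rho> b) (ren \<rho> p)"

abbreviation wk :: "nat \<Rightarrow> tm \<Rightarrow> tm" where
  "wk k \<equiv> ren (\<lambda>n. n + k)"

definition scons :: "tm \<Rightarrow> (nat \<Rightarrow> tm) \<Rightarrow> nat \<Rightarrow> tm" (infixr "\<cdot>" 65) where
  "a \<cdot> \<sigma> = case_nat a \<sigma>"

definition shift :: "nat \<Rightarrow> nat \<Rightarrow> tm" where
  "shift k n = Var (n + k)"

definition up :: "(nat \<Rightarrow> tm) \<Rightarrow> nat \<Rightarrow> tm" where
  "up \<sigma> = Var 0 \<cdot> (\<lambda>n. wk 1 (\<sigma> n))"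

primrec sub :: "(nat \<Rightarrow> tm) \<Rightarrow> tm \<Rightarrow> tm" where
  "sub \<sigma> (Var n) = \<sigma> n"
| "sub \<sigma> (Univ i) = Univ i"
| "sub \<sigma> (Pi A B) = Pi (sub \<sigma> A) (sub (up \<sigma>) B)"
| "sub \<sigma> (Lam A b) = Lam (sub \<sigma> A) (sub (up \<sigma>) b)"
| "sub \<sigma> (App f a) = App (sub \<sigma> f) (sub \<sigma> a)"
| "sub \<sigma> (Sig A B) = Sig (sub \<sigma> A) (sub (up \<sigma>) B)"
| "sub \<sigma> (Pr a b) = Pr (sub \<sigma> a) (sub \<sigma> b)"
| "sub \<sigma> (SigInd C g p) = SigInd (sub (up \<sigma>) C) (sub (up (up \<sigma>)) g) (sub \<sigma> p)"
| "sub \<sigma> (Coprod A B) = Coprod (sub \<sigma> A) (sub \<sigma> B)"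
| "sub \<sigma> (InL a) = InL (sub \<sigma> a)"
| "sub \<sigma> (InR b) = InR (sub \<sigma> b)"
| "sub \<sigma> (CoprodInd C c d e) =
     CoprodInd (sub (up \<sigma>) C) (sub (up \<sigma>) c) (sub (up \<sigma>) d) (sub \<sigma> e)"
| "sub \<sigma> EmptyT = EmptyT"
| "sub \<sigma> (EmptyInd C a) = EmptyInd (sub (up \<sigma>) C) (sub \<sigma> a)"
| "sub \<sigma> UnitT = UnitT"
| "sub \<sigma> Star = Star"
| "sub \<sigma> (UnitInd C c a) = UnitInd (sub (up \<sigma>) C) (sub \<sigma> c) (sub \<sigma> a)"
| "sub \<sigma> NatT = NatT"
| "sub \<sigma> Zero = Zero"
| "sub \<sigma> (Succ n) = Succ (sub \<sigma> n)"
| "sub \<sigma> (NatInd C c d n) =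
     NatInd (sub (up \<sigma>) C) (sub \<sigma> c) (sub (up (up \<sigma>)) d) (sub \<sigma> n)"
| "sub \<sigma> (IdT A a b) = IdT (sub \<sigma> A) (sub \<sigma> a) (sub \<sigma> b)"
| "sub \<sigma> (Refl a) = Refl (sub \<sigma> a)"
| "sub \<sigma> (IdInd C c a b p) =
     IdInd (sub (up (up (up \<sigma>))) C) (sub (up \<sigma>) c) (sub \<sigma> a) (sub \<sigma> b) (sub \<sigma> p)"

abbreviation inst1 :: "tm \<Rightarrow> tm \<Rightarrow> tm" where
  "inst1 C a \<equiv> sub (a \<cdot> shift 0) C"

abbreviation inst2 :: "tm \<Rightarrow> tm \<Rightarrow> tm \<Rightarrow> tm" where
  "inst2 C a b \<equiv> sub (b \<cdot> a \<cdot> shift 0) C"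

abbreviation inst3 :: "tm \<Rightarrow> tm \<Rightarrow> tm \<Rightarrow> tm \<Rightarrow> tm" where
  "inst3 C a b c \<equiv> sub (c \<cdot> b \<cdot> a \<cdot> shift 0) C"

text \<open>
  A context lists its types, with the most recent one first; each entry lives in the context formed by
  the entries after it.  ``\<open>A\<close> is a type'' is the judgement \<open>\<Gamma> \<turnstile> A \<Colon> Univ i\<close> for some level \<open>i\<close>.
\<close>

inductive wf_ctx :: "tm list \<Rightarrow> bool"
  and has_type :: "tm list \<Rightarrow> tm \<Rightarrow> tm \<Rightarrow> bool" ("(_ \<turnstile>/ _ \<Colon>/ _)" [51, 51, 51] 50)
  and judg_eq :: "tm list \<Rightarrow> tm \<Rightarrow> tm \<Rightarrow> tm \<Rightarrow> bool" ("(_ \<turnstile>/ _ \<doteq>/ _ \<Colon>/ _)" [51, 51, 51, 51] 50)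
where
  ctx_empty: "wf_ctx []"
| ctx_ext: "\<lbrakk>wf_ctx \<Gamma>; \<Gamma> \<turnstile> A \<Colon> Univ i\<rbrakk> \<Longrightarrow> wf_ctx (A # \<Gamma>)"
| var: "\<lbrakk>wf_ctx \<Gamma>; n < length \<Gamma>\<rbrakk> \<Longrightarrow> \<Gamma> \<turnstile> Var n \<Colon> wk (Suc n) (\<Gamma> ! n)"

| eq_refl: "\<Gamma> \<turnstile> a \<Colon> A \<Longrightarrow> \<Gamma> \<turnstile> a \<doteq> a \<Colon> A"
| eq_sym: "\<Gamma> \<turnstile> a \<doteq> b \<Colon> A \<Longrightarrow> \<Gamma> \<turnstile> b \<doteq> a \<Colon> A"
| eq_trans: "\<lbrakk>\<Gamma> \<turnstile> a \<doteq> b \<Colon> A; \<Gamma> \<turnstile> b \<doteq> c \<Colon> A\<rbrakk> \<Longrightarrow> \<Gamma> \<turnstile> a \<doteq> c \<Colon> A"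
| conv: "\<lbrakk>\<Gamma> \<turnstile> a \<Colon> A; \<Gamma> \<turnstile> A \<doteq> B \<Colon> Univ i\<rbrakk> \<Longrightarrow> \<Gamma> \<turnstile> a \<Colon> B"
| eq_conv: "\<lbrakk>\<Gamma> \<turnstile> a \<doteq> b \<Colon> A; \<Gamma> \<turnstile> A \<doteq> B \<Colon> Univ i\<rbrakk> \<Longrightarrow> \<Gamma> \<turnstile> a \<doteq> b \<Colon> B"

| univ_intro: "wf_ctx \<Gamma> \<Longrightarrow> \<Gamma> \<turnstile> Univ i \<Colon> Univ (Suc i)"
| univ_cumul: "\<Gamma> \<turnstile> A \<Colon> Univ i \<Longrightarrow> \<Gamma> \<turnstile> A \<Colon> Univ (Suc i)"
| univ_cumul_eq: "\<Gamma> \<turnstile> A \<doteq> B \<Colon> Univ i \<Longrightarrow> \<Gamma> \<turnstile> A \<doteq> B \<Colon> Univ (Suc i)"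

| pi_form: "\<lbrakk>\<Gamma> \<turnstile> A \<Colon> Univ i; A # \<Gamma> \<turnstile> B \<Colon> Univ i\<rbrakk> \<Longrightarrow> \<Gamma> \<turnstile> Pi A B \<Colon> Univ i"
| pi_intro: "A # \<Gamma> \<turnstile> b \<Colon> B \<Longrightarrow> \<Gamma> \<turnstile> Lam A b \<Colon> Pi A B"
| pi_elim: "\<lbrakk>\<Gamma> \<turnstile> f \<Colon> Pi A B; \<Gamma> \<turnstile> a \<Colon> A\<rbrakk> \<Longrightarrow> \<Gamma> \<turnstile> App f a \<Colon> inst1 B a"
| pi_comp: "\<lbrakk>A # \<Gamma> \<turnstile> b \<Colon> B; \<Gamma> \<turnstile> a \<Colon> A\<rbrakk> \<Longrightarrow> \<Gamma> \<turnstile> App (Lam A b) a \<doteq> inst1 b a \<Colon> inst1 B a"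
| pi_uniq: "\<Gamma> \<turnstile> f \<Colon> Pi A B \<Longrightarrow> \<Gamma> \<turnstile> f \<doteq> Lam A (App (wk 1 f) (Var 0)) \<Colon> Pi A B"
| pi_form_eq: "\<lbrakk>\<Gamma> \<turnstile> A \<doteq> A' \<Colon> Univ i; A # \<Gamma> \<turnstile> B \<doteq> B' \<Colon> Univ i\<rbrakk> \<Longrightarrow> \<Gamma> \<turnstile> Pi A B \<doteq> Pi A' B' \<Colon> Univ i"
| pi_intro_eq: "\<lbrakk>\<Gamma> \<turnstile> A \<doteq> A' \<Colon> Univ i; A # \<Gamma> \<turnstile> b \<doteq> b' \<Colon> B\<rbrakk> \<Longrightarrow> \<Gamma> \<turnstile> Lam A b \<doteq> Lam A' b' \<Colon> Pi A B"
| pi_elim_eq: "\<lbrakk>\<Gamma> \<turnstile> f \<doteq> f' \<Colon> Pi A B; \<Gamma> \<turnstile> a \<doteq> a' \<Colon> A\<rbrakk> \<Longrightarrow> \<Gamma> \<turnstile> App f a \<doteq> App f' a' \<Colon> inst1 B a"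

| sig_form: "\<lbrakk>\<Gamma> \<turnstile> A \<Colon> Univ i; A # \<Gamma> \<turnstile> B \<Colon> Univ i\<rbrakk> \<Longrightarrow> \<Gamma> \<turnstile> Sig A B \<Colon> Univ i"
| sig_intro: "\<lbrakk>A # \<Gamma> \<turnstile> B \<Colon> Univ i; \<Gamma> \<turnstile> a \<Colon> A; \<Gamma> \<turnstile> b \<Colon> inst1 B a\<rbrakk> \<Longrightarrow> \<Gamma> \<turnstile> Pr a b \<Colon> Sig A B"
| sig_elim:
    "\<lbrakk>Sig A B # \<Gamma> \<turnstile> C \<Colon> Univ i; B # A # \<Gamma> \<turnstile> g \<Colon> sub (Pr (Var 1) (Var 0) \<cdot> shift 2) C;
      \<Gamma> \<turnstile> p \<Colon> Sig A B\<rbrakk> \<Longrightarrow> \<Gamma> \<turnstile> SigInd C g p \<Colon> inst1 C p"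
| sig_comp:
    "\<lbrakk>Sig A B # \<Gamma> \<turnstile> C \<Colon> Univ i; B # A # \<Gamma> \<turnstile> g \<Colon> sub (Pr (Var 1) (Var 0) \<cdot> shift 2) C;
      \<Gamma> \<turnstile> a \<Colon> A; \<Gamma> \<turnstile> b \<Colon> inst1 B a\<rbrakk>
     \<Longrightarrow> \<Gamma> \<turnstile> SigInd C g (Pr a b) \<doteq> inst2 g a b \<Colon> inst1 C (Pr a b)"
| sig_form_eq: "\<lbrakk>\<Gamma> \<turnstile> A \<doteq> A' \<Colon> Univ i; A # \<Gamma> \<turnstile> B \<doteq> B' \<Colon> Univ i\<rbrakk> \<Longrightarrow> \<Gamma> \<turnstile> Sig A B \<doteq> Sig A' B' \<Colon> Univ i"
| sig_intro_eq:
    "\<lbrakk>A # \<Gamma> \<turnstile> B \<Colon> Univ i; \<Gamma> \<turnstile> a \<doteq> a' \<Colon> A; \<Gamma> \<turnstile> b \<doteq> b' \<Colon> inst1 B a\<rbrakk>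
     \<Longrightarrow> \<Gamma> \<turnstile> Pr a b \<doteq> Pr a' b' \<Colon> Sig A B"
| sig_elim_eq:
    "\<lbrakk>Sig A B # \<Gamma> \<turnstile> C \<doteq> C' \<Colon> Univ i; B # A # \<Gamma> \<turnstile> g \<doteq> g' \<Colon> sub (Pr (Var 1) (Var 0) \<cdot> shift 2) C;
      \<Gamma> \<turnstile> p \<doteq> p' \<Colon> Sig A B\<rbrakk> \<Longrightarrow> \<Gamma> \<turnstile> SigInd C g p \<doteq> SigInd C' g' p' \<Colon> inst1 C p"

| coprod_form: "\<lbrakk>\<Gamma> \<turnstile> A \<Colon> Univ i; \<Gamma> \<turnstile> B \<Colon> Univ i\<rbrakk> \<Longrightarrow> \<Gamma> \<turnstile> Coprod A B \<Colon> Univ i"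
| coprod_intro1: "\<lbrakk>\<Gamma> \<turnstile> A \<Colon> Univ i; \<Gamma> \<turnstile> B \<Colon> Univ i; \<Gamma> \<turnstile> a \<Colon> A\<rbrakk> \<Longrightarrow> \<Gamma> \<turnstile> InL a \<Colon> Coprod A B"
| coprod_intro2: "\<lbrakk>\<Gamma> \<turnstile> A \<Colon> Univ i; \<Gamma> \<turnstile> B \<Colon> Univ i; \<Gamma> \<turnstile> b \<Colon> B\<rbrakk> \<Longrightarrow> \<Gamma> \<turnstile> InR b \<Colon> Coprod A B"
| coprod_elim:
    "\<lbrakk>Coprod A B # \<Gamma> \<turnstile> C \<Colon> Univ i;
      A # \<Gamma> \<turnstile> c \<Colon> sub (InL (Var 0) \<cdot> shift 1) C; B # \<Gamma> \<turnstile> d \<Colon> sub (InR (Var 0) \<cdot> shift 1) C;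
      \<Gamma> \<turnstile> e \<Colon> Coprod A B\<rbrakk> \<Longrightarrow> \<Gamma> \<turnstile> CoprodInd C c d e \<Colon> inst1 C e"
| coprod_comp1:
    "\<lbrakk>Coprod A B # \<Gamma> \<turnstile> C \<Colon> Univ i;
      A # \<Gamma> \<turnstile> c \<Colon> sub (InL (Var 0) \<cdot> shift 1) C; B # \<Gamma> \<turnstile> d \<Colon> sub (InR (Var 0) \<cdot> shift 1) C;
      \<Gamma> \<turnstile> a \<Colon> A\<rbrakk> \<Longrightarrow> \<Gamma> \<turnstile> CoprodInd C c d (InL a) \<doteq> inst1 c a \<Colon> inst1 C (InL a)"
| coprod_comp2:
    "\<lbrakk>Coprod A B # \<Gamma> \<turnstile> C \<Colon> Univ i;
      A # \<Gamma> \<turnstile> c \<Colon> sub (InL (Var 0) \<cdot> shift 1) C; B # \<Gamma> \<turnstile> d \<Colon> sub (InR (Var 0) \<cdot> shift 1) C;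
      \<Gamma> \<turnstile> b \<Colon> B\<rbrakk> \<Longrightarrow> \<Gamma> \<turnstile> CoprodInd C c d (InR b) \<doteq> inst1 d b \<Colon> inst1 C (InR b)"
| coprod_form_eq:
    "\<lbrakk>\<Gamma> \<turnstile> A \<doteq> A' \<Colon> Univ i; \<Gamma> \<turnstile> B \<doteq> B' \<Colon> Univ i\<rbrakk> \<Longrightarrow> \<Gamma> \<turnstile> Coprod A B \<doteq> Coprod A' B' \<Colon> Univ i"
| coprod_intro1_eq:
    "\<lbrakk>\<Gamma> \<turnstile> A \<Colon> Univ i; \<Gamma> \<turnstile> B \<Colon> Univ i; \<Gamma> \<turnstile> a \<doteq> a' \<Colon> A\<rbrakk> \<Longrightarrow> \<Gamma> \<turnstile> InL a \<doteq> InL a' \<Colon> Coprod A B"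
| coprod_intro2_eq:
    "\<lbrakk>\<Gamma> \<turnstile> A \<Colon> Univ i; \<Gamma> \<turnstile> B \<Colon> Univ i; \<Gamma> \<turnstile> b \<doteq> b' \<Colon> B\<rbrakk> \<Longrightarrow> \<Gamma> \<turnstile> InR b \<doteq> InR b' \<Colon> Coprod A B"
| coprod_elim_eq:
    "\<lbrakk>Coprod A B # \<Gamma> \<turnstile> C \<doteq> C' \<Colon> Univ i;
      A # \<Gamma> \<turnstile> c \<doteq> c' \<Colon> sub (InL (Var 0) \<cdot> shift 1) C;
      B # \<Gamma> \<turnstile> d \<doteq> d' \<Colon> sub (InR (Var 0) \<cdot> shift 1) C; \<Gamma> \<turnstile> e \<doteq> e' \<Colon> Coprod A B\<rbrakk>
     \<Longrightarrow> \<Gamma> \<turnstile> CoprodInd C c d e \<doteq> CoprodInd C' c' d' e' \<Colon> inst1 C e"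

| empty_form: "wf_ctx \<Gamma> \<Longrightarrow> \<Gamma> \<turnstile> EmptyT \<Colon> Univ i"
| empty_elim: "\<lbrakk>EmptyT # \<Gamma> \<turnstile> C \<Colon> Univ i; \<Gamma> \<turnstile> a \<Colon> EmptyT\<rbrakk> \<Longrightarrow> \<Gamma> \<turnstile> EmptyInd C a \<Colon> inst1 C a"
| empty_elim_eq:
    "\<lbrakk>EmptyT # \<Gamma> \<turnstile> C \<doteq> C' \<Colon> Univ i; \<Gamma> \<turnstile> a \<doteq> a' \<Colon> EmptyT\<rbrakk>
     \<Longrightarrow> \<Gamma> \<turnstile> EmptyInd C a \<doteq> EmptyInd C' a' \<Colon> inst1 C a"

| unit_form: "wf_ctx \<Gamma> \<Longrightarrow> \<Gamma> \<turnstile> UnitT \<Colon> Univ i"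
| unit_intro: "wf_ctx \<Gamma> \<Longrightarrow> \<Gamma> \<turnstile> Star \<Colon> UnitT"
| unit_elim:
    "\<lbrakk>UnitT # \<Gamma> \<turnstile> C \<Colon> Univ i; \<Gamma> \<turnstile> c \<Colon> inst1 C Star; \<Gamma> \<turnstile> a \<Colon> UnitT\<rbrakk>
     \<Longrightarrow> \<Gamma> \<turnstile> UnitInd C c a \<Colon> inst1 C a"
| unit_comp:
    "\<lbrakk>UnitT # \<Gamma> \<turnstile> C \<Colon> Univ i; \<Gamma> \<turnstile> c \<Colon> inst1 C Star\<rbrakk>
     \<Longrightarrow> \<Gamma> \<turnstile> UnitInd C c Star \<doteq> c \<Colon> inst1 C Star"
| unit_elim_eq:
    "\<lbrakk>UnitT # \<Gamma> \<turnstile> C \<doteq> C' \<Colon> Univ i; \<Gamma> \<turnstile> c \<doteq> c' \<Colon> inst1 C Star; \<Gamma> \<turnstile> a \<doteq> a' \<Colon> UnitT\<rbrakk>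
     \<Longrightarrow> \<Gamma> \<turnstile> UnitInd C c a \<doteq> UnitInd C' c' a' \<Colon> inst1 C a"

| nat_form: "wf_ctx \<Gamma> \<Longrightarrow> \<Gamma> \<turnstile> NatT \<Colon> Univ i"
| nat_intro1: "wf_ctx \<Gamma> \<Longrightarrow> \<Gamma> \<turnstile> Zero \<Colon> NatT"
| nat_intro2: "\<Gamma> \<turnstile> n \<Colon> NatT \<Longrightarrow> \<Gamma> \<turnstile> Succ n \<Colon> NatT"
| nat_elim:
    "\<lbrakk>NatT # \<Gamma> \<turnstile> C \<Colon> Univ i; \<Gamma> \<turnstile> c \<Colon> inst1 C Zero;
      C # NatT # \<Gamma> \<turnstile> d \<Colon> sub (Succ (Var 1) \<cdot> shift 2) C; \<Gamma> \<turnstile> n \<Colon> NatT\<rbrakk>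
     \<Longrightarrow> \<Gamma> \<turnstile> NatInd C c d n \<Colon> inst1 C n"
| nat_comp1:
    "\<lbrakk>NatT # \<Gamma> \<turnstile> C \<Colon> Univ i; \<Gamma> \<turnstile> c \<Colon> inst1 C Zero;
      C # NatT # \<Gamma> \<turnstile> d \<Colon> sub (Succ (Var 1) \<cdot> shift 2) C\<rbrakk>
     \<Longrightarrow> \<Gamma> \<turnstile> NatInd C c d Zero \<doteq> c \<Colon> inst1 C Zero"
| nat_comp2:
    "\<lbrakk>NatT # \<Gamma> \<turnstile> C \<Colon> Univ i; \<Gamma> \<turnstile> c \<Colon> inst1 C Zero;
      C # NatT # \<Gamma> \<turnstile> d \<Colon> sub (Succ (Var 1) \<cdot> shift 2) C; \<Gamma> \<turnstile> n \<Colon> NatT\<rbrakk>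
     \<Longrightarrow> \<Gamma> \<turnstile> NatInd C c d (Succ n) \<doteq> inst2 d n (NatInd C c d n) \<Colon> inst1 C (Succ n)"
| nat_intro2_eq: "\<Gamma> \<turnstile> n \<doteq> n' \<Colon> NatT \<Longrightarrow> \<Gamma> \<turnstile> Succ n \<doteq> Succ n' \<Colon> NatT"
| nat_elim_eq:
    "\<lbrakk>NatT # \<Gamma> \<turnstile> C \<doteq> C' \<Colon> Univ i; \<Gamma> \<turnstile> c \<doteq> c' \<Colon> inst1 C Zero;
      C # NatT # \<Gamma> \<turnstile> d \<doteq> d' \<Colon> sub (Succ (Var 1) \<cdot> shift 2) C; \<Gamma> \<turnstile> n \<doteq> n' \<Colon> NatT\<rbrakk>
     \<Longrightarrow> \<Gamma> \<turnstile> NatInd C c d n \<doteq> NatInd C' c' d' n' \<Colon> inst1 C n"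

| id_form: "\<lbrakk>\<Gamma> \<turnstile> A \<Colon> Univ i; \<Gamma> \<turnstile> a \<Colon> A; \<Gamma> \<turnstile> b \<Colon> A\<rbrakk> \<Longrightarrow> \<Gamma> \<turnstile> IdT A a b \<Colon> Univ i"
| id_intro: "\<lbrakk>\<Gamma> \<turnstile> A \<Colon> Univ i; \<Gamma> \<turnstile> a \<Colon> A\<rbrakk> \<Longrightarrow> \<Gamma> \<turnstile> Refl a \<Colon> IdT A a a"
| id_elim:
    "\<lbrakk>IdT (wk 2 A) (Var 1) (Var 0) # wk 1 A # A # \<Gamma> \<turnstile> C \<Colon> Univ i;
      A # \<Gamma> \<turnstile> c \<Colon> sub (Refl (Var 0) \<cdot> Var 0 \<cdot> Var 0 \<cdot> shift 1) C;
      \<Gamma> \<turnstile> a \<Colon> A; \<Gamma> \<turnstile> b \<Colon> A; \<Gamma> \<turnstile> p \<Colon> IdT A a b\<rbrakk>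
     \<Longrightarrow> \<Gamma> \<turnstile> IdInd C c a b p \<Colon> inst3 C a b p"
| id_comp:
    "\<lbrakk>IdT (wk 2 A) (Var 1) (Var 0) # wk 1 A # A # \<Gamma> \<turnstile> C \<Colon> Univ i;
      A # \<Gamma> \<turnstile> c \<Colon> sub (Refl (Var 0) \<cdot> Var 0 \<cdot> Var 0 \<cdot> shift 1) C; \<Gamma> \<turnstile> a \<Colon> A\<rbrakk>
     \<Longrightarrow> \<Gamma> \<turnstile> IdInd C c a a (Refl a) \<doteq> inst1 c a \<Colon> inst3 C a a (Refl a)"
| id_form_eq:
    "\<lbrakk>\<Gamma> \<turnstile> A \<doteq> A' \<Colon> Univ i; \<Gamma> \<turnstile> a \<doteq> a' \<Colon> A; \<Gamma> \<turnstile> b \<doteq> b' \<Colon> A\<rbrakk>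
     \<Longrightarrow> \<Gamma> \<turnstile> IdT A a b \<doteq> IdT A' a' b' \<Colon> Univ i"
| id_intro_eq: "\<lbrakk>\<Gamma> \<turnstile> A \<Colon> Univ i; \<Gamma> \<turnstile> a \<doteq> a' \<Colon> A\<rbrakk> \<Longrightarrow> \<Gamma> \<turnstile> Refl a \<doteq> Refl a' \<Colon> IdT A a a"
| id_elim_eq:
    "\<lbrakk>IdT (wk 2 A) (Var 1) (Var 0) # wk 1 A # A # \<Gamma> \<turnstile> C \<doteq> C' \<Colon> Univ i;
      A # \<Gamma> \<turnstile> c \<doteq> c' \<Colon> sub (Refl (Var 0) \<cdot> Var 0 \<cdot> Var 0 \<cdot> shift 1) C;
      \<Gamma> \<turnstile> a \<doteq> a' \<Colon> A; \<Gamma> \<turnstile> b \<doteq> b' \<Colon> A; \<Gamma> \<turnstile> p \<doteq> p' \<Colon> IdT A a b\<rbrakk>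
     \<Longrightarrow> \<Gamma> \<turnstile> IdInd C c a b p \<doteq> IdInd C' c' a' b' p' \<Colon> inst3 C a b p"

definition arrow :: "tm \<Rightarrow> tm \<Rightarrow> tm" where
  "arrow A B = Pi A (wk 1 B)"

text \<open>\<open>\<Prod>(x y : X). \<Prod>(p q : x = y). p = q\<close>\<close>

definition is_set :: "tm \<Rightarrow> tm" where
  "is_set X =
     Pi X (Pi (wk 1 X) (Pi (IdT (wk 2 X) (Var 1) (Var 0)) (Pi (IdT (wk 3 X) (Var 2) (Var 1))
       (IdT (IdT (wk 4 X) (Var 3) (Var 2)) (Var 1) (Var 0)))))"

text \<open>\<open>\<Prod>(x : X). f (f x) = f x\<close>\<close>

definition idempotence :: "tm \<Rightarrow> tm \<Rightarrow> tm" where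
  "idempotence X f =
     Pi X (IdT (wk 1 X) (App (wk 1 f) (App (wk 1 f) (Var 0))) (App (wk 1 f) (Var 0)))"

text \<open>\<open>\<Sum>(A : U\<^sub>i). \<Sum>(r : X \<rightarrow> A). \<Sum>(s : A \<rightarrow> X). \<Sum>(H : \<Prod>(a : A). r (s a) = a). \<Prod>(x : X). s (r x) = f x\<close>\<close>

definition splitting :: "nat \<Rightarrow> tm \<Rightarrow> tm \<Rightarrow> tm" where
  "splitting i X f =
     Sig (Univ i)
      (Sig (arrow (wk 1 X) (Var 0))
        (Sig (arrow (Var 1) (wk 2 X))
          (Sig (Pi (Var 2) (IdT (Var 3) (App (Var 2) (App (Var 1) (Var 0))) (Var 0)))
            (Pi (wk 4 X)
              (IdT (wk 5 X) (App (Var 2) (App (Var 3) (Var 0))) (App (wk 5 f) (Var 0)))))))"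

end

theory Submission
  imports Defs
begin

text \<open>
  \<open>f\<close> splits through its type of fixed points \<open>A = \<Sum>(x : X). f x = x\<close>, with \<open>r x = (f x, I x)\<close> and
  \<open>s\<close> the first projection.  Then \<open>s (r x)\<close> is judgementally \<open>f x\<close>, and \<open>r (s (x, p))\<close> is judgementally
  \<open>(f x, I x)\<close>, so it remains to identify \<open>(f x, I x)\<close> with \<open>(x, p)\<close>.  Path induction on \<open>p : f x = x\<close>,
  generalised over both second components, reduces this to pairs with the same first component \<open>y\<close>,
  whose second components are parallel paths \<open>f y = y\<close> in the set \<open>X\<close>.
\<close>

section \<open>Renaming and substitution\<close>

text \<open>Substitutions compute on \<open>0\<close> and \<open>Suc n\<close>. Concrete indices are
  therefore first rewritten to successor form with \<open>eval_nat_numeral\<close> in the proofs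
  below.\<close>

lemma scons_simps [simp]: "(a \<cdot> \<sigma>) 0 = a" "(a \<cdot> \<sigma>) (Suc n) = \<sigma> n"
  by (simp_all add: scons_def)

lemma shift_apply [simp]: "shift m n = Var (n + m)"
  by (simp add: shift_def)

lemma up_simps [simp]: "up \<sigma> 0 = Var 0" "up \<sigma> (Suc n) = wk 1 (\<sigma> n)"
  by (simp_all add: up_def)

lemma up_ren_simps [simp]: "up_ren \<rho> 0 = 0" "up_ren \<rho> (Suc n) = Suc (\<rho> n)"
  by (simp_all add: up_ren_def)

lemma up_comp_up_ren: "(\<lambda>n. up \<sigma> (up_ren \<rho> n)) = up (\<lambda>n. \<sigma> (\<rho> n))"
proof
  show "up \<sigma> (up_ren \<rho> n) = up (\<lambda>n. \<sigma> (\<rho> n)) n" for n by (cases n) simp_all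
qed

lemma up_ren_comp: "(\<lambda>n. up_ren \<rho> (up_ren \<rho>' n)) = up_ren (\<lambda>n. \<rho> (\<rho>' n))"
proof
  show "up_ren \<rho> (up_ren \<rho>' n) = up_ren (\<lambda>n. \<rho> (\<rho>' n)) n" for n by (cases n) simp_all
qed

lemma up_Var_comp: "up (\<lambda>n. Var (\<rho> n)) = (\<lambda>n. Var (up_ren \<rho> n))"
proof
  show "up (\<lambda>n. Var (\<rho> n)) n = Var (up_ren \<rho> n)" for n by (cases n) simp_all
qed

lemma up_ren_id: "up_ren (\<lambda>n. n) = (\<lambda>n. n)"
proof
  show "up_ren (\<lambda>n. n) n = n" for n by (cases n) simp_all
qed

text \<open>The induction generalises both maps because each binder lifts them. With
  \<open>ren_ren\<close>, \<open>sub_Var_comp\<close> and \<open>ren_sub\<close>, this fuses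
  composites into one traversal; in particular \<open>inst1 (wk 1 t) a\<close> simplifies to
  \<open>t\<close>.\<close>

lemma sub_ren [simp]: "sub \<sigma> (ren \<rho> t) = sub (\<lambda>n. \<sigma> (\<rho> n)) t"
  by (induction t arbitrary: \<sigma> \<rho>) (simp_all add: up_comp_up_ren)

lemma ren_ren [simp]: "ren \<rho> (ren \<rho>' t) = ren (\<lambda>n. \<rho> (\<rho>' n)) t"
  by (induction t arbitrary: \<rho> \<rho>') (simp_all add: up_ren_comp)

lemma sub_Var_comp [simp]: "sub (\<lambda>n. Var (\<rho> n)) t = ren \<rho> t"
  by (induction t arbitrary: \<rho>) (simp_all add: up_Var_comp)

lemma ren_id [simp]: "ren (\<lambda>n. n) t = t"
  by (induction t) (simp_all add: up_ren_id)

lemma sub_Var [simp]: "sub Var t = t"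
  using sub_Var_comp[of "\<lambda>n. n" t] by simp

lemma ren_up: "(\<lambda>n. ren (up_ren \<rho>) (up \<sigma> n)) = up (\<lambda>n. ren \<rho> (\<sigma> n))"
proof
  show "ren (up_ren \<rho>) (up \<sigma> n) = up (\<lambda>n. ren \<rho> (\<sigma> n)) n" for n by (cases n) simp_all
qed

lemma ren_sub [simp]: "ren \<rho> (sub \<sigma> t) = sub (\<lambda>n. ren \<rho> (\<sigma> n)) t"
  by (induction t arbitrary: \<rho> \<sigma>) (simp_all add: ren_up)

lemma ren_arrow [simp]: "ren \<rho> (arrow A B) = arrow (ren \<rho> A) (ren \<rho> B)"
  by (simp add: arrow_def)

lemma sub_arrow [simp]: "sub \<sigma> (arrow A B) = arrow (sub \<sigma> A) (sub \<sigma> B)"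
  by (simp add: arrow_def)

section \<open>Derived rules\<close>

text \<open>The type is a free \<open>T\<close> tied by an equation, so the weakening produced by
  \<open>var\<close> is settled by simplification instead of syntactic matching.
  \<open>pi_elim_of_type\<close> does the same for instantiation.\<close>

lemma var_of_type:
  assumes "wf_ctx \<Gamma>" "n < length \<Gamma>" "wk (Suc n) (\<Gamma> ! n) = T"
  shows "\<Gamma> \<turnstile> Var n \<Colon> T"
  using var[OF assms(1,2)] assms(3) by simp

lemma pi_elim_of_type:
  assumes "\<Gamma> \<turnstile> f \<Colon> Pi A B" "\<Gamma> \<turnstile> a \<Colon> A" "inst1 B a = T"
  shows "\<Gamma> \<turnstile> App f a \<Colon> T"
  using pi_elim[OF assms(1,2)] assms(3) by simp

text \<open>The calculus has no weakening rule, so the typing of the weakened codomain is a premise,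
  to be derived directly at each use.\<close>

lemma arrow_form:
  "\<lbrakk>\<Gamma> \<turnstile> A \<Colon> Univ i; A # \<Gamma> \<turnstile> wk 1 B \<Colon> Univ i\<rbrakk> \<Longrightarrow> \<Gamma> \<turnstile> arrow A B \<Colon> Univ i"
  unfolding arrow_def by (rule pi_form)

lemma arrow_elim: "\<lbrakk>\<Gamma> \<turnstile> f \<Colon> arrow A B; \<Gamma> \<turnstile> a \<Colon> A\<rbrakk> \<Longrightarrow> \<Gamma> \<turnstile> App f a \<Colon> B"
  unfolding arrow_def by (erule pi_elim_of_type) simp_all

lemma arrow_elim_eq:
  "\<lbrakk>\<Gamma> \<turnstile> f \<Colon> arrow A B; \<Gamma> \<turnstile> a \<doteq> a' \<Colon> A\<rbrakk> \<Longrightarrow> \<Gamma> \<turnstile> App f a \<doteq> App f a' \<Colon> B"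
  unfolding arrow_def by (drule pi_elim_eq[OF eq_refl]) simp_all

section \<open>The ambient context\<close>

definition hyps :: "nat \<Rightarrow> tm list" where
  "hyps i = [idempotence (Var 2) (Var 0), arrow (Var 1) (Var 1), is_set (Var 0), Univ i]"

text \<open>In a context with \<open>k\<close> entries on top of the hypotheses, the idempotence witness, \<open>f\<close>, the
  set witness and \<open>X\<close> are the variables \<open>k\<close>, \<open>k + 1\<close>, \<open>k + 2\<close> and \<open>k + 3\<close>.\<close>

definition idem_ctx :: "nat \<Rightarrow> nat \<Rightarrow> tm list \<Rightarrow> bool" where
  "idem_ctx i k \<Gamma> \<longleftrightarrow> wf_ctx \<Gamma> \<and> (\<exists>\<Delta>. length \<Delta> = k \<and> \<Gamma> = \<Delta> @ hyps i)"

lemma idem_ctx_wf: "idem_ctx i k \<Gamma> \<Longrightarrow> wf_ctx \<Gamma>"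
  by (simp add: idem_ctx_def)

text \<open>This takes the place of weakening: facts about the hypotheses are proved for every depth
  \<open>k\<close>, and going under a binder means reusing them at \<open>Suc k\<close>. The level
  \<open>j\<close> is free because the splitting also binds \<open>Univ i\<close>, whose own level
  is \<open>Suc i\<close>.\<close>

lemma idem_ctx_ext:
  assumes "idem_ctx i k \<Gamma>" "\<Gamma> \<turnstile> A \<Colon> Univ j"
  shows "idem_ctx i (Suc k) (A # \<Gamma>)"
proof -
  obtain \<Delta> where "wf_ctx \<Gamma>" "length \<Delta> = k" "\<Gamma> = \<Delta> @ hyps i"
    using assms(1) by (auto simp: idem_ctx_def)
  then show ?thesis
    using assms(2) ctx_ext[of \<Gamma> A j] by (auto simp: idem_ctx_def intro!: exI[of _ "A # \<Delta>"])
qed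

lemma idem_ctx_var:
  assumes "idem_ctx i k \<Gamma>" "j < 4" "wk (Suc (k + j)) (hyps i ! j) = T"
  shows "\<Gamma> \<turnstile> Var (k + j) \<Colon> T"
proof (rule var_of_type)
  show "wf_ctx \<Gamma>" using assms(1) by (rule idem_ctx_wf)
  have len: "length (hyps i) = 4" by (simp add: hyps_def)
  then show "k + j < length \<Gamma>" using assms(1,2) by (auto simp: idem_ctx_def)
  show "wk (Suc (k + j)) (\<Gamma> ! (k + j)) = T"
    using assms len by (auto simp: idem_ctx_def nth_append)
qed

lemma carrier_type: "idem_ctx i k \<Gamma> \<Longrightarrow> \<Gamma> \<turnstile> Var (k + 3) \<Colon> Univ i"
  by (rule idem_ctx_var) (auto simp: hyps_def)

lemma idem_fun: "idem_ctx i k \<Gamma> \<Longrightarrow> \<Gamma> \<turnstile> Var (k + 1) \<Colon> arrow (Var (k + 3)) (Var (k + 3))"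
  by (rule idem_ctx_var) (auto simp: hyps_def arrow_def eval_nat_numeral)

lemma idem_fun_app:
  "\<lbrakk>idem_ctx i k \<Gamma>; \<Gamma> \<turnstile> a \<Colon> Var (k + 3)\<rbrakk> \<Longrightarrow> \<Gamma> \<turnstile> App (Var (k + 1)) a \<Colon> Var (k + 3)"
  by (rule arrow_elim[OF idem_fun])

lemma idem_witness_app:
  assumes "idem_ctx i k \<Gamma>" "\<Gamma> \<turnstile> a \<Colon> Var (k + 3)"
  shows "\<Gamma> \<turnstile> App (Var k) a \<Colon>
    IdT (Var (k + 3)) (App (Var (k + 1)) (App (Var (k + 1)) a)) (App (Var (k + 1)) a)"
proof (rule pi_elim_of_type[OF _ assms(2)])
  show "\<Gamma> \<turnstile> Var k \<Colon> Pi (Var (k + 3))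
      (IdT (Var (k + 4)) (App (Var (k + 2)) (App (Var (k + 2)) (Var 0))) (App (Var (k + 2)) (Var 0)))"
    using idem_ctx_var[OF assms(1), of 0] by (simp add: hyps_def idempotence_def eval_nat_numeral)
qed (simp add: eval_nat_numeral)

text \<open>The four products are opened one at a time: the remaining type carries weakened copies
  of the arguments already supplied, and each further instantiation strips one weakening.\<close>

lemma set_witness_app:
  assumes \<Gamma>: "idem_ctx i k \<Gamma>" and a: "\<Gamma> \<turnstile> a \<Colon> Var (k + 3)" and b: "\<Gamma> \<turnstile> b \<Colon> Var (k + 3)"
    and p: "\<Gamma> \<turnstile> p \<Colon> IdT (Var (k + 3)) a b" and q: "\<Gamma> \<turnstile> q \<Colon> IdT (Var (k + 3)) a b"
  shows "\<Gamma> \<turnstile> App (App (App (App (Var (k + 2)) a) b) p) q \<Colon> IdT (IdT (Var (k + 3)) a b) p q"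
proof -
  have "\<Gamma> \<turnstile> Var (k + 2) \<Colon> wk (Suc (k + 2)) (is_set (Var 0))"
    using idem_ctx_var[OF \<Gamma>, of 2] by (simp add: hyps_def)
  then have "\<Gamma> \<turnstile> Var (k + 2) \<Colon> is_set (Var (k + 3))"
    by (simp add: is_set_def eval_nat_numeral)
  then have "\<Gamma> \<turnstile> App (Var (k + 2)) a \<Colon>
      Pi (Var (k + 3)) (Pi (IdT (Var (k + 4)) (wk 1 a) (Var 0)) (Pi (IdT (Var (k + 5)) (wk 2 a) (Var 1))
       (IdT (IdT (Var (k + 6)) (wk 3 a) (Var 2)) (Var 1) (Var 0))))"
    unfolding is_set_def by (rule pi_elim_of_type[OF _ a]) (simp add: eval_nat_numeral)
  then have "\<Gamma> \<turnstile> App (App (Var (k + 2)) a) b \<Colon>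
      Pi (IdT (Var (k + 3)) a b) (Pi (IdT (Var (k + 4)) (wk 1 a) (wk 1 b))
       (IdT (IdT (Var (k + 5)) (wk 2 a) (wk 2 b)) (Var 1) (Var 0)))"
    by (rule pi_elim_of_type[OF _ b]) (simp add: eval_nat_numeral)
  then have "\<Gamma> \<turnstile> App (App (App (Var (k + 2)) a) b) p \<Colon>
      Pi (IdT (Var (k + 3)) a b) (IdT (IdT (Var (k + 4)) (wk 1 a) (wk 1 b)) (wk 1 p) (Var 0))"
    by (rule pi_elim_of_type[OF _ p]) (simp add: eval_nat_numeral)
  then show ?thesis
    by (rule pi_elim_of_type[OF _ q]) (simp add: eval_nat_numeral)
qed

section \<open>The type of fixed points\<close>

definition fix_eq :: "nat \<Rightarrow> tm \<Rightarrow> tm" where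
  "fix_eq k a = IdT (Var (k + 3)) (App (Var (k + 1)) a) a"

definition fix_type :: "nat \<Rightarrow> tm" where
  "fix_type k = Sig (Var (k + 3)) (fix_eq (k + 1) (Var 0))"

text \<open>Looking up position \<open>n\<close> weakens \<open>Var m\<close> to index
  \<open>m + n + 1\<close>. This is \<open>k + 3\<close>, the index of X, exactly when
  \<open>n + m = k + 2\<close>.\<close>

lemma carrier_var:
  assumes "idem_ctx i k \<Gamma>" "n < length \<Gamma>" "\<Gamma> ! n = Var m" "n + m = k + 2"
  shows "\<Gamma> \<turnstile> Var n \<Colon> Var (k + 3)"
  using assms by (intro var_of_type) (auto simp: idem_ctx_wf)

lemma fix_eq_form:
  assumes "idem_ctx i k \<Gamma>" "\<Gamma> \<turnstile> a \<Colon> Var (k + 3)"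
  shows "\<Gamma> \<turnstile> fix_eq k a \<Colon> Univ i"
  unfolding fix_eq_def using assms by (intro id_form carrier_type idem_fun_app)

lemma ctx_carrier: "idem_ctx i k \<Gamma> \<Longrightarrow> idem_ctx i (k + 1) (Var (k + 3) # \<Gamma>)"
  using idem_ctx_ext[OF _ carrier_type] by simp

lemma ctx_fix_eq:
  assumes "idem_ctx i k \<Gamma>" "\<Gamma> \<turnstile> a \<Colon> Var (k + 3)"
  shows "idem_ctx i (k + 1) (fix_eq k a # \<Gamma>)"
  using idem_ctx_ext[OF assms(1) fix_eq_form[OF assms]] by simp

lemma fix_family_form:
  assumes "idem_ctx i k \<Gamma>"
  shows "Var (k + 3) # \<Gamma> \<turnstile> fix_eq (k + 1) (Var 0) \<Colon> Univ i"
  using fix_eq_form[OF ctx_carrier[OF assms] carrier_var[OF ctx_carrier[OF assms]], of 0] by simp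

lemma fix_type_form: "idem_ctx i k \<Gamma> \<Longrightarrow> \<Gamma> \<turnstile> fix_type k \<Colon> Univ i"
  unfolding fix_type_def by (intro sig_form carrier_type fix_family_form)

lemma ctx_fix_type: "idem_ctx i k \<Gamma> \<Longrightarrow> idem_ctx i (k + 1) (fix_type k # \<Gamma>)"
  using idem_ctx_ext[OF _ fix_type_form] by simp

text \<open>Written with \<open>Suc k\<close>, the form to which simplification brings
  \<open>k + 1\<close>.\<close>

lemma inst_fix_eq [simp]: "inst1 (fix_eq (Suc k) (Var 0)) a = fix_eq k a"
  by (simp add: fix_eq_def eval_nat_numeral)

text \<open>The only free variables are X and f, whose indices are counted from the depth, so
  weakening merely shifts the depth.\<close>

lemma wk_fix_type: "wk m (fix_type k) = fix_type (k + m)"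
  by (simp add: fix_type_def fix_eq_def eval_nat_numeral)

lemma fix_pair:
  assumes "idem_ctx i k \<Gamma>" "\<Gamma> \<turnstile> a \<Colon> Var (k + 3)" "\<Gamma> \<turnstile> p \<Colon> fix_eq k a"
  shows "\<Gamma> \<turnstile> Pr a p \<Colon> fix_type k"
  unfolding fix_type_def using assms by (intro sig_intro fix_family_form) simp_all

text \<open>This is the context in which the motive of a path induction over \<open>A\<close> lives.
  The typings of the weakened copies of \<open>A\<close> are premises for want of a weakening
  rule.\<close>

lemma ctx_paths:
  assumes "idem_ctx i k \<Gamma>" "\<Gamma> \<turnstile> A \<Colon> Univ i" "A # \<Gamma> \<turnstile> wk 1 A \<Colon> Univ i"
    "wk 1 A # A # \<Gamma> \<turnstile> wk 2 A \<Colon> Univ i"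
  shows "idem_ctx i (k + 3) (IdT (wk 2 A) (Var 1) (Var 0) # wk 1 A # A # \<Gamma>)"
proof -
  have c: "idem_ctx i (Suc (Suc k)) (wk 1 A # A # \<Gamma>)"
    by (rule idem_ctx_ext[OF idem_ctx_ext[OF assms(1,2)] assms(3)])
  have "wk 1 A # A # \<Gamma> \<turnstile> IdT (wk 2 A) (Var 1) (Var 0) \<Colon> Univ i"
    by (intro id_form assms(4) var_of_type idem_ctx_wf[OF c]) (simp_all add: eval_nat_numeral)
  from idem_ctx_ext[OF c this] show ?thesis by (simp add: eval_nat_numeral)
qed

text \<open>The action on paths of pairing with the base point \<open>Var n\<close>, applied to the
  path from \<open>u\<close> to \<open>v\<close> that the set hypothesis supplies.\<close>

definition fix_pair_path :: "nat \<Rightarrow> nat \<Rightarrow> tm \<Rightarrow> tm \<Rightarrow> tm" where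
  "fix_pair_path k n u v =
     IdInd (IdT (fix_type (k + 3)) (Pr (Var (n + 3)) (Var 2)) (Pr (Var (n + 3)) (Var 1)))
       (Refl (Pr (Var (n + 1)) (Var 0))) u v
       (App (App (App (App (Var (k + 2)) (App (Var (k + 1)) (Var n))) (Var n)) u) v)"

text \<open>The base point is a variable so that its weakenings, which occur in the motive, can be typed
  without an admissibility proof for weakening.\<close>

lemma fix_pair_path:
  assumes \<Gamma>: "idem_ctx i k \<Gamma>" and n: "n < length \<Gamma>" "\<Gamma> ! n = Var m" "n + m = k + 2"
    and u: "\<Gamma> \<turnstile> u \<Colon> fix_eq k (Var n)" and v: "\<Gamma> \<turnstile> v \<Colon> fix_eq k (Var n)"
  shows "\<Gamma> \<turnstile> fix_pair_path k n u v \<Colon> IdT (fix_type k) (Pr (Var n) u) (Pr (Var n) v)"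
proof -
  let ?E = "fix_eq k (Var n)"
  let ?P = "IdT (wk 2 ?E) (Var 1) (Var 0)"
  let ?C = "IdT (fix_type (k + 3)) (Pr (Var (n + 3)) (Var 2)) (Pr (Var (n + 3)) (Var 1))"
  have x: "\<Gamma> \<turnstile> Var n \<Colon> Var (k + 3)"
    by (rule carrier_var[OF \<Gamma> n])
  have E: "\<Gamma> \<turnstile> ?E \<Colon> Univ i"
    by (rule fix_eq_form[OF \<Gamma> x])
  have c1: "idem_ctx i (k + 1) (?E # \<Gamma>)"
    by (rule ctx_fix_eq[OF \<Gamma> x])
  have x1: "?E # \<Gamma> \<turnstile> Var (n + 1) \<Colon> Var (k + 1 + 3)"
    using n by (intro carrier_var[OF c1]) simp_all
  have E1: "?E # \<Gamma> \<turnstile> wk 1 ?E \<Colon> Univ i"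
    using fix_eq_form[OF c1 x1] by (simp add: fix_eq_def)
  have c2: "idem_ctx i (k + 2) (wk 1 ?E # ?E # \<Gamma>)"
    using idem_ctx_ext[OF c1 E1] by simp
  have x2: "wk 1 ?E # ?E # \<Gamma> \<turnstile> Var (n + 2) \<Colon> Var (k + 2 + 3)"
    using n by (intro carrier_var[OF c2]) simp_all
  have E2: "wk 1 ?E # ?E # \<Gamma> \<turnstile> wk 2 ?E \<Colon> Univ i"
    using fix_eq_form[OF c2 x2] by (simp add: fix_eq_def add.commute add.left_commute)
  have c3: "idem_ctx i (k + 3) (?P # wk 1 ?E # ?E # \<Gamma>)"
    by (rule ctx_paths[OF \<Gamma> E E1 E2])
  have x3: "?P # wk 1 ?E # ?E # \<Gamma> \<turnstile> Var (n + 3) \<Colon> Var (k + 3 + 3)"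
    using n by (intro carrier_var[OF c3]) (simp_all add: eval_nat_numeral)
  \<comment> \<open>\<open>Var 2\<close> and \<open>Var 1\<close> are the endpoints of the path
    being eliminated. Both prove that the same base point, now at index \<open>n + 3\<close>, is
    fixed.\<close>
  have "?P # wk 1 ?E # ?E # \<Gamma> \<turnstile> Var 2 \<Colon> fix_eq (k + 3) (Var (n + 3))"
    "?P # wk 1 ?E # ?E # \<Gamma> \<turnstile> Var 1 \<Colon> fix_eq (k + 3) (Var (n + 3))"
    by (intro var_of_type idem_ctx_wf[OF c3]; simp add: fix_eq_def eval_nat_numeral)+
  then have C: "?P # wk 1 ?E # ?E # \<Gamma> \<turnstile> ?C \<Colon> Univ i"
    by (intro id_form fix_type_form[OF c3] fix_pair[OF c3 x3])
  have u1: "?E # \<Gamma> \<turnstile> Var 0 \<Colon> fix_eq (k + 1) (Var (n + 1))"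
    by (intro var_of_type idem_ctx_wf[OF c1]) (simp_all add: fix_eq_def)
  have c: "?E # \<Gamma> \<turnstile> Refl (Pr (Var (n + 1)) (Var 0)) \<Colon>
      sub (Refl (Var 0) \<cdot> Var 0 \<cdot> Var 0 \<cdot> shift 1) ?C"
    using id_intro[OF fix_type_form[OF c1] fix_pair[OF c1 x1 u1]]
    by (simp add: fix_type_def fix_eq_def eval_nat_numeral)
  \<comment> \<open>Both \<open>u\<close> and \<open>v\<close> run from f y to y for y =
    \<open>Var n\<close>, so these are the endpoints at which the set hypothesis is used.\<close>
  have p: "\<Gamma> \<turnstile> App (App (App (App (Var (k + 2)) (App (Var (k + 1)) (Var n))) (Var n)) u) v \<Colon> IdT ?E u v"
    using set_witness_app[OF \<Gamma> idem_fun_app[OF \<Gamma> x] x] u v by (simp add: fix_eq_def)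
  show ?thesis
    using id_elim[OF C c u v p] by (simp add: fix_pair_path_def fix_type_def fix_eq_def eval_nat_numeral)
qed

text \<open>In the motive the two occurrences of \<open>Var 2\<close> differ: the first is the left
  endpoint y, while one binder deeper the same index is the right endpoint z. Under both proofs y
  and z have indices 4 and 3.\<close>

definition fix_path :: "nat \<Rightarrow> tm \<Rightarrow> tm \<Rightarrow> tm \<Rightarrow> tm \<Rightarrow> tm \<Rightarrow> tm" where
  "fix_path k y z q u v =
     App (App
       (IdInd
         (Pi (fix_eq (k + 3) (Var 2)) (Pi (fix_eq (k + 4) (Var 2))
           (IdT (fix_type (k + 5)) (Pr (Var 4) (Var 1)) (Pr (Var 3) (Var 0)))))
         (Lam (fix_eq (k + 1) (Var 0)) (Lam (fix_eq (k + 2) (Var 1))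
           (fix_pair_path (k + 3) 2 (Var 1) (Var 0))))
         y z q) u) v"

text \<open>Quantifying over both fixed-point proofs before the path induction on \<open>q\<close> avoids transports:
  it reduces the claim to equal base points, where the set hypothesis identifies the two proofs.\<close>

lemma fix_path:
  assumes \<Gamma>: "idem_ctx i k \<Gamma>" and y: "\<Gamma> \<turnstile> y \<Colon> Var (k + 3)" and z: "\<Gamma> \<turnstile> z \<Colon> Var (k + 3)"
    and q: "\<Gamma> \<turnstile> q \<Colon> IdT (Var (k + 3)) y z"
    and u: "\<Gamma> \<turnstile> u \<Colon> fix_eq k y" and v: "\<Gamma> \<turnstile> v \<Colon> fix_eq k z"
  shows "\<Gamma> \<turnstile> fix_path k y z q u v \<Colon> IdT (fix_type k) (Pr y u) (Pr z v)"
proof -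
  let ?X = "Var (k + 3)"
  let ?D = "IdT (wk 2 ?X) (Var 1) (Var 0) # wk 1 ?X # ?X # \<Gamma>"
  let ?C = "Pi (fix_eq (k + 3) (Var 2)) (Pi (fix_eq (k + 4) (Var 2))
           (IdT (fix_type (k + 5)) (Pr (Var 4) (Var 1)) (Pr (Var 3) (Var 0))))"
  let ?c = "Lam (fix_eq (k + 1) (Var 0)) (Lam (fix_eq (k + 2) (Var 1))
           (fix_pair_path (k + 3) 2 (Var 1) (Var 0)))"
  have X: "\<Gamma> \<turnstile> ?X \<Colon> Univ i"
    by (rule carrier_type[OF \<Gamma>])
  have c1: "idem_ctx i (k + 1) (?X # \<Gamma>)"
    by (rule ctx_carrier[OF \<Gamma>])
  have X1: "?X # \<Gamma> \<turnstile> wk 1 ?X \<Colon> Univ i"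
    using carrier_type[OF c1] by simp
  have c2: "idem_ctx i (k + 2) (wk 1 ?X # ?X # \<Gamma>)"
    using idem_ctx_ext[OF c1 X1] by simp
  have X2: "wk 1 ?X # ?X # \<Gamma> \<turnstile> wk 2 ?X \<Colon> Univ i"
    using carrier_type[OF c2] by (simp add: eval_nat_numeral)
  have c3: "idem_ctx i (k + 3) ?D"
    by (rule ctx_paths[OF \<Gamma> X X1 X2])
  have y3: "?D \<turnstile> Var 2 \<Colon> Var (k + 3 + 3)"
    by (intro carrier_var[OF c3]) (simp_all add: eval_nat_numeral)
  let ?D4 = "fix_eq (k + 3) (Var 2) # ?D"
  have c4: "idem_ctx i (k + 4) ?D4"
    using ctx_fix_eq[OF c3 y3] by (simp add: eval_nat_numeral)
  have z4: "?D4 \<turnstile> Var 2 \<Colon> Var (k + 4 + 3)"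
    by (intro carrier_var[OF c4]) (simp_all add: eval_nat_numeral)
  let ?D5 = "fix_eq (k + 4) (Var 2) # ?D4"
  have c5: "idem_ctx i (k + 5) ?D5"
    using ctx_fix_eq[OF c4 z4] by (simp add: eval_nat_numeral)
  have y5: "?D5 \<turnstile> Var 4 \<Colon> Var (k + 5 + 3)" and z5: "?D5 \<turnstile> Var 3 \<Colon> Var (k + 5 + 3)"
    by (intro carrier_var[OF c5]; simp add: eval_nat_numeral)+
  have u5: "?D5 \<turnstile> Var 1 \<Colon> fix_eq (k + 5) (Var 4)" and v5: "?D5 \<turnstile> Var 0 \<Colon> fix_eq (k + 5) (Var 3)"
    by (intro var_of_type idem_ctx_wf[OF c5]; simp add: fix_eq_def eval_nat_numeral)+
  have C: "?D \<turnstile> ?C \<Colon> Univ i"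
    by (intro pi_form fix_eq_form[OF c3 y3] fix_eq_form[OF c4 z4] id_form fix_type_form[OF c5]
        fix_pair[OF c5 y5 u5] fix_pair[OF c5 z5 v5])
  have a1: "?X # \<Gamma> \<turnstile> Var 0 \<Colon> Var (k + 1 + 3)"
    by (intro carrier_var[OF c1]) simp_all
  let ?E2 = "fix_eq (k + 1) (Var 0) # ?X # \<Gamma>"
  have e2: "idem_ctx i (k + 2) ?E2"
    using ctx_fix_eq[OF c1 a1] by simp
  have a2: "?E2 \<turnstile> Var 1 \<Colon> Var (k + 2 + 3)"
    by (intro carrier_var[OF e2]) simp_all
  let ?E3 = "fix_eq (k + 2) (Var 1) # ?E2"
  have e3: "idem_ctx i (k + 3) ?E3"
    using ctx_fix_eq[OF e2 a2] by (simp add: eval_nat_numeral)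
  have u3: "?E3 \<turnstile> Var 1 \<Colon> fix_eq (k + 3) (Var 2)" and v3: "?E3 \<turnstile> Var 0 \<Colon> fix_eq (k + 3) (Var 2)"
    by (intro var_of_type idem_ctx_wf[OF e3]; simp add: fix_eq_def eval_nat_numeral)+
  \<comment> \<open>In the reflexivity case y and z are both \<open>Var 2\<close>, so the two pairs
    share a base point that is a variable.\<close>
  have "?E3 \<turnstile> fix_pair_path (k + 3) 2 (Var 1) (Var 0) \<Colon>
      IdT (fix_type (k + 3)) (Pr (Var 2) (Var 1)) (Pr (Var 2) (Var 0))"
    by (rule fix_pair_path[OF e3 _ _ _ u3 v3]) (simp_all add: eval_nat_numeral)
  from pi_intro[OF pi_intro[OF this]]
  have c: "?X # \<Gamma> \<turnstile> ?c \<Colon> sub (Refl (Var 0) \<cdot> Var 0 \<cdot> Var 0 \<cdot> shift 1) ?C"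
    by (simp add: fix_type_def fix_eq_def eval_nat_numeral)
  have "\<Gamma> \<turnstile> IdInd ?C ?c y z q \<Colon>
      Pi (fix_eq k y) (Pi (fix_eq (k + 1) (wk 1 z))
        (IdT (fix_type (k + 2)) (Pr (wk 2 y) (Var 1)) (Pr (wk 2 z) (Var 0))))"
    using id_elim[OF C c y z q] by (simp add: fix_type_def fix_eq_def eval_nat_numeral)
  then have "\<Gamma> \<turnstile> App (IdInd ?C ?c y z q) u \<Colon>
      Pi (fix_eq k z) (IdT (fix_type (k + 1)) (Pr (wk 1 y) (wk 1 u)) (Pr (wk 1 z) (Var 0)))"
    by (rule pi_elim_of_type[OF _ u]) (simp add: fix_type_def fix_eq_def eval_nat_numeral)
  then show ?thesis
    unfolding fix_path_def
    by (rule pi_elim_of_type[OF _ v]) (simp add: fix_type_def fix_eq_def eval_nat_numeral)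
qed

section \<open>The retraction and the section\<close>

definition retr :: "nat \<Rightarrow> tm" where
  "retr k = Lam (Var (k + 3)) (Pr (App (Var (k + 2)) (Var 0)) (App (Var (k + 1)) (Var 0)))"

text \<open>The first projection, as an elimination with constant motive. \<open>Var (k + 5)\<close>
  is X seen under the abstraction and the variable of the motive; \<open>Var 1\<close> is the first
  component.\<close>

definition sect :: "nat \<Rightarrow> tm" where
  "sect k = Lam (fix_type k) (SigInd (Var (k + 5)) (Var 1) (Var 0))"

lemma idem_pair:
  assumes "idem_ctx i k \<Gamma>" "\<Gamma> \<turnstile> a \<Colon> Var (k + 3)"
  shows "\<Gamma> \<turnstile> Pr (App (Var (k + 1)) a) (App (Var k) a) \<Colon> fix_type k"
  using fix_pair[OF assms(1) idem_fun_app[OF assms]] idem_witness_app[OF assms]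
  by (simp add: fix_eq_def)

lemma retr_body:
  assumes "idem_ctx i k \<Gamma>"
  shows "Var (k + 3) # \<Gamma> \<turnstile> Pr (App (Var (k + 2)) (Var 0)) (App (Var (k + 1)) (Var 0)) \<Colon> fix_type (k + 1)"
  using idem_pair[OF ctx_carrier[OF assms] carrier_var[OF ctx_carrier[OF assms]], of 0] by simp

lemma retr_type: "idem_ctx i k \<Gamma> \<Longrightarrow> \<Gamma> \<turnstile> retr k \<Colon> arrow (Var (k + 3)) (fix_type k)"
  using pi_intro[OF retr_body] by (simp add: retr_def arrow_def wk_fix_type[of 1, simplified])

lemma retr_comp:
  assumes "idem_ctx i k \<Gamma>" "\<Gamma> \<turnstile> a \<Colon> Var (k + 3)"
  shows "\<Gamma> \<turnstile> App (retr k) a \<doteq> Pr (App (Var (k + 1)) a) (App (Var k) a) \<Colon> fix_type k"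
  using pi_comp[OF retr_body[OF assms(1)] assms(2)]
  by (simp add: retr_def fix_type_def fix_eq_def eval_nat_numeral)

lemma sect_motive:
  assumes "idem_ctx i k \<Gamma>"
  shows "fix_type k # \<Gamma> \<turnstile> Var (k + 4) \<Colon> Univ i"
  using carrier_type[OF ctx_fix_type[OF assms]] by (simp add: eval_nat_numeral)

lemma sect_branch:
  assumes "idem_ctx i k \<Gamma>"
  shows "fix_eq (k + 1) (Var 0) # Var (k + 3) # \<Gamma> \<turnstile> Var 1 \<Colon> Var (k + 5)"
proof -
  have "idem_ctx i (k + 2) (fix_eq (k + 1) (Var 0) # Var (k + 3) # \<Gamma>)"
    using idem_ctx_ext[OF ctx_carrier[OF assms] fix_family_form[OF assms]] by simp
  from carrier_var[OF this, of 1] show ?thesis by (simp add: eval_nat_numeral)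
qed

lemma sect_body:
  assumes "idem_ctx i k \<Gamma>"
  shows "fix_type k # \<Gamma> \<turnstile> SigInd (Var (k + 5)) (Var 1) (Var 0) \<Colon> Var (k + 4)"
proof -
  have c: "idem_ctx i (k + 1) (fix_type k # \<Gamma>)"
    by (rule ctx_fix_type[OF assms])
  have "fix_type k # \<Gamma> \<turnstile> Var 0 \<Colon> fix_type (k + 1)"
    by (intro var_of_type idem_ctx_wf[OF c]) (simp_all add: wk_fix_type[of 1, simplified])
  from sig_elim[OF sect_motive[OF c, unfolded fix_type_def] _ this[unfolded fix_type_def]]
    sect_branch[OF c]
  show ?thesis by (simp add: eval_nat_numeral fix_type_def fix_eq_def)
qed

lemma sect_type: "idem_ctx i k \<Gamma> \<Longrightarrow> \<Gamma> \<turnstile> sect k \<Colon> arrow (fix_type k) (Var (k + 3))"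
  using pi_intro[OF sect_body] by (simp add: sect_def arrow_def eval_nat_numeral)

text \<open>\<open>pi_comp\<close> opens the abstraction and \<open>sig_comp\<close> then projects
  from the pair.\<close>

lemma sect_comp:
  assumes \<Gamma>: "idem_ctx i k \<Gamma>" and a: "\<Gamma> \<turnstile> a \<Colon> Var (k + 3)" and p: "\<Gamma> \<turnstile> p \<Colon> fix_eq k a"
  shows "\<Gamma> \<turnstile> App (sect k) (Pr a p) \<doteq> a \<Colon> Var (k + 3)"
proof (rule eq_trans)
  show "\<Gamma> \<turnstile> App (sect k) (Pr a p) \<doteq> SigInd (Var (k + 4)) (Var 1) (Pr a p) \<Colon> Var (k + 3)"
    using pi_comp[OF sect_body[OF \<Gamma>] fix_pair[OF assms]] by (simp add: sect_def eval_nat_numeral)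
  show "\<Gamma> \<turnstile> SigInd (Var (k + 4)) (Var 1) (Pr a p) \<doteq> a \<Colon> Var (k + 3)"
    using sig_comp[OF sect_motive[OF \<Gamma>, unfolded fix_type_def] _ a, of "Var 1" p] sect_branch[OF \<Gamma>] p
    by (simp add: eval_nat_numeral)
qed

text \<open>Congruence and computation suffice here, which is why the homotopy K can be
  reflexivity.\<close>

lemma sect_retr_eq:
  assumes \<Gamma>: "idem_ctx i k \<Gamma>" and a: "\<Gamma> \<turnstile> a \<Colon> Var (k + 3)"
  shows "\<Gamma> \<turnstile> App (sect k) (App (retr k) a) \<doteq> App (Var (k + 1)) a \<Colon> Var (k + 3)"
proof (rule eq_trans[OF arrow_elim_eq[OF sect_type[OF \<Gamma>] retr_comp[OF \<Gamma> a]]])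
  show "\<Gamma> \<turnstile> App (sect k) (Pr (App (Var (k + 1)) a) (App (Var k) a)) \<doteq> App (Var (k + 1)) a \<Colon> Var (k + 3)"
    using sect_comp[OF \<Gamma> idem_fun_app[OF \<Gamma> a]] idem_witness_app[OF \<Gamma> a] by (simp add: fix_eq_def)
qed

text \<open>Computation alone yields (f a, I a) rather than (a, p); the remaining gap is closed by a
  path, in \<open>retr_sect_path\<close>.\<close>

lemma retr_sect_eq:
  assumes \<Gamma>: "idem_ctx i k \<Gamma>" and a: "\<Gamma> \<turnstile> a \<Colon> Var (k + 3)" and p: "\<Gamma> \<turnstile> p \<Colon> fix_eq k a"
  shows "\<Gamma> \<turnstile> App (retr k) (App (sect k) (Pr a p)) \<doteq> Pr (App (Var (k + 1)) a) (App (Var k) a) \<Colon> fix_type k"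
  by (rule eq_trans[OF arrow_elim_eq[OF retr_type[OF \<Gamma>] sect_comp[OF assms]] retr_comp[OF \<Gamma> a]])

section \<open>Types and inhabitants of the two homotopies\<close>

lemma retraction_form:
  assumes "\<Gamma> \<turnstile> A \<Colon> Univ i" "A # \<Gamma> \<turnstile> wk 1 A \<Colon> Univ i"
    and "A # \<Gamma> \<turnstile> r \<Colon> arrow X (wk 1 A)" "A # \<Gamma> \<turnstile> s \<Colon> arrow (wk 1 A) X" "wf_ctx (A # \<Gamma>)"
  shows "\<Gamma> \<turnstile> Pi A (IdT (wk 1 A) (App r (App s (Var 0))) (Var 0)) \<Colon> Univ i"
proof -
  have "A # \<Gamma> \<turnstile> Var 0 \<Colon> wk 1 A"
    by (rule var_of_type) (simp_all add: assms(5))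
  then show ?thesis
    using assms(1,2) by (intro pi_form id_form arrow_elim[OF assms(3)] arrow_elim[OF assms(4)])
qed

text \<open>Generic in \<open>r\<close>, \<open>s\<close> and \<open>A\<close>: these begin as bound
  variables and are replaced by \<open>retr\<close>, \<open>sect\<close> and \<open>fix_type\<close>
  as the components of the splitting are filled in.\<close>

lemma factorization_form:
  assumes \<Gamma>: "idem_ctx i k \<Gamma>"
    and r: "Var (k + 3) # \<Gamma> \<turnstile> r \<Colon> arrow (Var (k + 4)) A"
    and s: "Var (k + 3) # \<Gamma> \<turnstile> s \<Colon> arrow A (Var (k + 4))"
  shows "\<Gamma> \<turnstile> Pi (Var (k + 3)) (IdT (Var (k + 4)) (App s (App r (Var 0))) (App (Var (k + 2)) (Var 0))) \<Colon> Univ i"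
proof -
  have c: "idem_ctx i (k + 1) (Var (k + 3) # \<Gamma>)"
    by (rule ctx_carrier[OF \<Gamma>])
  have x: "Var (k + 3) # \<Gamma> \<turnstile> Var 0 \<Colon> Var (k + 4)"
    using carrier_var[OF c, of 0] by (simp add: eval_nat_numeral)
  have X: "Var (k + 3) # \<Gamma> \<turnstile> Var (k + 4) \<Colon> Univ i"
    using carrier_type[OF c] by (simp add: eval_nat_numeral)
  have "Var (k + 3) # \<Gamma> \<turnstile> App (Var (k + 2)) (Var 0) \<Colon> Var (k + 4)"
    using idem_fun_app[OF c] x by (simp add: eval_nat_numeral)
  then show ?thesis
    by (intro pi_form id_form X carrier_type[OF \<Gamma>] arrow_elim[OF s] arrow_elim[OF r] x)
qed

text \<open>The section computes only on pairs, so the fixed point is first split by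
  \<open>SigInd\<close>. On a pair (x, p) the claim becomes a path from (f x, I x) to (x, p), given
  by \<open>fix_path\<close>.\<close>

lemma retr_sect_path:
  assumes \<Gamma>: "idem_ctx i k \<Gamma>"
  shows "\<exists>h. \<Gamma> \<turnstile> h \<Colon> Pi (fix_type k)
    (IdT (fix_type (k + 1)) (App (retr (k + 1)) (App (sect (k + 1)) (Var 0))) (Var 0))"
proof -
  let ?A = "fix_type k" and ?D = "fix_type (k + 1) # fix_type k # \<Gamma>"
  let ?C = "IdT (fix_type (k + 2)) (App (retr (k + 2)) (App (sect (k + 2)) (Var 0))) (Var 0)"
  have c1: "idem_ctx i (k + 1) (?A # \<Gamma>)"
    by (rule ctx_fix_type[OF \<Gamma>])
  have c2: "idem_ctx i (k + 2) ?D"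
    using ctx_fix_type[OF c1] by simp
  have a2: "?D \<turnstile> Var 0 \<Colon> fix_type (k + 2)"
    by (intro var_of_type idem_ctx_wf[OF c2]) (simp_all add: wk_fix_type[of 1, simplified])
  have C: "?D \<turnstile> ?C \<Colon> Univ i"
    by (intro id_form fix_type_form[OF c2] arrow_elim[OF retr_type[OF c2]]
        arrow_elim[OF sect_type[OF c2]] a2)
  let ?B = "fix_eq (k + 2) (Var 0) # Var (k + 4) # ?A # \<Gamma>"
  have b: "idem_ctx i (k + 3) ?B"
    using idem_ctx_ext[OF ctx_carrier[OF c1] fix_family_form[OF c1]] by (simp add: eval_nat_numeral)
  have x: "?B \<turnstile> Var 1 \<Colon> Var (k + 3 + 3)"
    by (rule carrier_var[OF b]) (simp_all add: eval_nat_numeral)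
  have p: "?B \<turnstile> Var 0 \<Colon> fix_eq (k + 3) (Var 1)"
    by (intro var_of_type idem_ctx_wf[OF b]) (simp_all add: fix_eq_def eval_nat_numeral)
  have fx: "?B \<turnstile> App (Var (k + 3 + 1)) (Var 1) \<Colon> Var (k + 3 + 3)"
    by (rule idem_fun_app[OF b x])
  \<comment> \<open>\<open>Var 0\<close>, the path p from f x to x, is used twice: it joins the two
    base points and it is the second component of the target pair. The first component proof is I
    x.\<close>
  let ?g = "fix_path (k + 3) (App (Var (k + 3 + 1)) (Var 1)) (Var 1) (Var 0) (App (Var (k + 3)) (Var 1)) (Var 0)"
  have "?B \<turnstile> ?g \<Colon> IdT (fix_type (k + 3))
      (Pr (App (Var (k + 3 + 1)) (Var 1)) (App (Var (k + 3)) (Var 1))) (Pr (Var 1) (Var 0))"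
    using p idem_witness_app[OF b x] by (intro fix_path[OF b fx x]) (simp_all add: fix_eq_def)
  \<comment> \<open>The left endpoint is converted back to its uncomputed form, as the branch of
    \<open>SigInd\<close> requires.\<close>
  then have "?B \<turnstile> ?g \<Colon> IdT (fix_type (k + 3))
      (App (retr (k + 3)) (App (sect (k + 3)) (Pr (Var 1) (Var 0)))) (Pr (Var 1) (Var 0))"
    by (rule conv[OF _ id_form_eq[OF eq_refl[OF fix_type_form[OF b]]
        eq_sym[OF retr_sect_eq[OF b x p]] eq_refl[OF fix_pair[OF b x p]]]])
  then have g: "fix_eq (k + 1 + 1) (Var 0) # Var (k + 1 + 3) # ?A # \<Gamma> \<turnstile> ?g \<Colon>
      sub (Pr (Var 1) (Var 0) \<cdot> shift 2) ?C"
    by (simp add: retr_def sect_def fix_type_def fix_eq_def eval_nat_numeral)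
  have a1: "?A # \<Gamma> \<turnstile> Var 0 \<Colon> fix_type (k + 1)"
    by (intro var_of_type idem_ctx_wf[OF c1]) (simp_all add: wk_fix_type[of 1, simplified])
  have "?A # \<Gamma> \<turnstile> SigInd ?C ?g (Var 0) \<Colon> inst1 ?C (Var 0)"
    using sig_elim[OF C[unfolded fix_type_def[of "k + 1"]] g a1[unfolded fix_type_def[of "k + 1"]]] .
  then have "?A # \<Gamma> \<turnstile> SigInd ?C ?g (Var 0) \<Colon>
      IdT (fix_type (k + 1)) (App (retr (k + 1)) (App (sect (k + 1)) (Var 0))) (Var 0)"
    by (simp add: retr_def sect_def fix_type_def fix_eq_def eval_nat_numeral)
  then show ?thesis by (blast intro: pi_intro)
qed

text \<open>Reflexivity at f x, retyped by conversion along \<open>sect_retr_eq\<close>.\<close>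

lemma sect_retr_path:
  assumes \<Gamma>: "idem_ctx i k \<Gamma>"
  shows "\<exists>h. \<Gamma> \<turnstile> h \<Colon> Pi (Var (k + 3))
    (IdT (Var (k + 4)) (App (sect (k + 1)) (App (retr (k + 1)) (Var 0))) (App (Var (k + 2)) (Var 0)))"
proof -
  let ?D = "Var (k + 3) # \<Gamma>"
  have c: "idem_ctx i (k + 1) ?D"
    by (rule ctx_carrier[OF \<Gamma>])
  have x: "?D \<turnstile> Var 0 \<Colon> Var (k + 1 + 3)"
    by (rule carrier_var[OF c]) simp_all
  have fx: "?D \<turnstile> App (Var (k + 1 + 1)) (Var 0) \<Colon> Var (k + 1 + 3)"
    by (rule idem_fun_app[OF c x])
  have "?D \<turnstile> Refl (App (Var (k + 1 + 1)) (Var 0)) \<Colon>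
      IdT (Var (k + 1 + 3)) (App (sect (k + 1)) (App (retr (k + 1)) (Var 0))) (App (Var (k + 1 + 1)) (Var 0))"
    by (rule conv[OF id_intro[OF carrier_type[OF c] fx] id_form_eq[OF eq_refl[OF carrier_type[OF c]]
        eq_sym[OF sect_retr_eq[OF c x]] eq_refl[OF fx]]])
  from pi_intro[OF this] show ?thesis by (auto simp: eval_nat_numeral)
qed

section \<open>Assembling the splitting\<close>

text \<open>\<open>sig_intro\<close> asks that the family of each Sigma-type be well formed, and the
  splitting nests four of them. In this outermost family A is still a variable.\<close>

lemma splitting_family_form:
  assumes \<Gamma>: "idem_ctx i k \<Gamma>"
  shows "Univ i # \<Gamma> \<turnstile>
    Sig (arrow (Var (k + 4)) (Var 0))
     (Sig (arrow (Var 1) (Var (k + 5)))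
       (Sig (Pi (Var 2) (IdT (Var 3) (App (Var 2) (App (Var 1) (Var 0))) (Var 0)))
         (Pi (Var (k + 7)) (IdT (Var (k + 8)) (App (Var 2) (App (Var 3) (Var 0)))
           (App (Var (k + 6)) (Var 0)))))) \<Colon> Univ i"
proof -
  let ?G1 = "Univ i # \<Gamma>"
  have c1: "idem_ctx i (k + 1) ?G1"
    using idem_ctx_ext[OF \<Gamma> univ_intro[OF idem_ctx_wf[OF \<Gamma>]]] by simp
  have X1: "?G1 \<turnstile> Var (k + 4) \<Colon> Univ i"
    using carrier_type[OF c1] by (simp add: eval_nat_numeral)
  have "wf_ctx (Var (k + 4) # ?G1)"
    by (rule ctx_ext[OF idem_ctx_wf[OF c1] X1])
  then have "Var (k + 4) # ?G1 \<turnstile> Var 1 \<Colon> Univ i"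
    by (rule var_of_type) simp_all
  with X1 have R: "?G1 \<turnstile> arrow (Var (k + 4)) (Var 0) \<Colon> Univ i"
    by (intro arrow_form) simp_all
  let ?G2 = "arrow (Var (k + 4)) (Var 0) # ?G1"
  have c2: "idem_ctx i (k + 2) ?G2"
    using idem_ctx_ext[OF c1 R] by simp
  have A2: "?G2 \<turnstile> Var 1 \<Colon> Univ i"
    by (rule var_of_type[OF idem_ctx_wf[OF c2]]) simp_all
  have "Var 1 # ?G2 \<turnstile> Var (k + 6) \<Colon> Univ i"
    using carrier_type[OF idem_ctx_ext[OF c2 A2]] by (simp add: eval_nat_numeral)
  with A2 have S: "?G2 \<turnstile> arrow (Var 1) (Var (k + 5)) \<Colon> Univ i"
    by (intro arrow_form) (simp_all add: eval_nat_numeral)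
  let ?G3 = "arrow (Var 1) (Var (k + 5)) # ?G2"
  have c3: "idem_ctx i (k + 3) ?G3"
    using idem_ctx_ext[OF c2 S] by (simp add: eval_nat_numeral)
  have A3: "?G3 \<turnstile> Var 2 \<Colon> Univ i"
    by (rule var_of_type[OF idem_ctx_wf[OF c3]]) (simp_all add: eval_nat_numeral)
  have w: "wf_ctx (Var 2 # ?G3)"
    by (rule ctx_ext[OF idem_ctx_wf[OF c3] A3])
  have A4: "Var 2 # ?G3 \<turnstile> Var 3 \<Colon> Univ i"
    and "Var 2 # ?G3 \<turnstile> Var 2 \<Colon> arrow (Var (k + 7)) (Var 3)"
    and "Var 2 # ?G3 \<turnstile> Var 1 \<Colon> arrow (Var 3) (Var (k + 7))"
    by (rule var_of_type[OF w]; simp add: eval_nat_numeral)+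
  with A3 w have H: "?G3 \<turnstile> Pi (Var 2) (IdT (Var 3) (App (Var 2) (App (Var 1) (Var 0))) (Var 0)) \<Colon> Univ i"
    using retraction_form[of ?G3 "Var 2" i "Var 2" "Var (k + 7)" "Var 1"] by (simp add: eval_nat_numeral)
  let ?G4 = "Pi (Var 2) (IdT (Var 3) (App (Var 2) (App (Var 1) (Var 0))) (Var 0)) # ?G3"
  have c4: "idem_ctx i (k + 4) ?G4"
    using idem_ctx_ext[OF c3 H] by (simp add: eval_nat_numeral)
  have w: "wf_ctx (Var (k + 4 + 3) # ?G4)"
    by (rule idem_ctx_wf[OF ctx_carrier[OF c4]])
  have "Var (k + 4 + 3) # ?G4 \<turnstile> Var 3 \<Colon> arrow (Var (k + 4 + 4)) (Var 4)"
    and "Var (k + 4 + 3) # ?G4 \<turnstile> Var 2 \<Colon> arrow (Var 4) (Var (k + 4 + 4))"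
    by (rule var_of_type[OF w]; simp add: eval_nat_numeral)+
  from factorization_form[OF c4 this]
  have "?G4 \<turnstile> Pi (Var (k + 7)) (IdT (Var (k + 8)) (App (Var 2) (App (Var 3) (Var 0)))
      (App (Var (k + 6)) (Var 0))) \<Colon> Univ i"
    by (simp add: eval_nat_numeral)
  then show ?thesis by (intro sig_form R S H)
qed

section \<open>Formation of the families once A is the type of fixed points\<close>

lemma ctx_arrow_carrier_fix:
  assumes "idem_ctx i k \<Gamma>"
  shows "idem_ctx i (k + 1) (arrow (Var (k + 3)) (fix_type k) # \<Gamma>)"
proof -
  have "\<Gamma> \<turnstile> arrow (Var (k + 3)) (fix_type k) \<Colon> Univ i"
    using fix_type_form[OF ctx_carrier[OF assms]]
    by (intro arrow_form carrier_type[OF assms]) (simp add: wk_fix_type[of 1, simplified])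
  from idem_ctx_ext[OF assms this] show ?thesis by simp
qed

lemma arrow_fix_carrier_form:
  assumes "idem_ctx i k \<Gamma>"
  shows "\<Gamma> \<turnstile> arrow (fix_type k) (Var (k + 3)) \<Colon> Univ i"
  using carrier_type[OF ctx_fix_type[OF assms]] by (intro arrow_form fix_type_form[OF assms]) simp

lemma ctx_arrow_fix_carrier:
  "idem_ctx i k \<Gamma> \<Longrightarrow> idem_ctx i (k + 1) (arrow (fix_type k) (Var (k + 3)) # \<Gamma>)"
  using idem_ctx_ext[OF _ arrow_fix_carrier_form] by simp

lemma fix_retraction_form:
  assumes \<Gamma>: "idem_ctx i k \<Gamma>"
    and r: "fix_type k # \<Gamma> \<turnstile> r \<Colon> arrow (Var (k + 4)) (fix_type (k + 1))"
    and s: "fix_type k # \<Gamma> \<turnstile> s \<Colon> arrow (fix_type (k + 1)) (Var (k + 4))"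
  shows "\<Gamma> \<turnstile> Pi (fix_type k) (IdT (fix_type (k + 1)) (App r (App s (Var 0))) (Var 0)) \<Colon> Univ i"
  using retraction_form[of \<Gamma> "fix_type k" i r "Var (k + 4)" s] assms fix_type_form[OF \<Gamma>]
    fix_type_form[OF ctx_fix_type[OF \<Gamma>]] idem_ctx_wf[OF ctx_fix_type[OF \<Gamma>]]
  by (simp add: wk_fix_type[of 1, simplified])

lemma splitting_family_form_fix:
  assumes \<Gamma>: "idem_ctx i k \<Gamma>"
  shows "arrow (Var (k + 3)) (fix_type k) # \<Gamma> \<turnstile>
    Sig (arrow (fix_type (k + 1)) (Var (k + 4)))
     (Sig (Pi (fix_type (k + 2)) (IdT (fix_type (k + 3)) (App (Var 2) (App (Var 1) (Var 0))) (Var 0)))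
       (Pi (Var (k + 6)) (IdT (Var (k + 7)) (App (Var 2) (App (Var 3) (Var 0)))
         (App (Var (k + 5)) (Var 0))))) \<Colon> Univ i"
proof -
  let ?G1 = "arrow (Var (k + 3)) (fix_type k) # \<Gamma>"
  have c1: "idem_ctx i (k + 1) ?G1"
    by (rule ctx_arrow_carrier_fix[OF \<Gamma>])
  have S: "?G1 \<turnstile> arrow (fix_type (k + 1)) (Var (k + 4)) \<Colon> Univ i"
    using arrow_fix_carrier_form[OF c1] by (simp add: eval_nat_numeral)
  let ?G2 = "arrow (fix_type (k + 1)) (Var (k + 4)) # ?G1"
  have c2: "idem_ctx i (k + 2) ?G2"
    using idem_ctx_ext[OF c1 S] by simp
  have w: "wf_ctx (fix_type (k + 2) # ?G2)"
    by (rule idem_ctx_wf[OF ctx_fix_type[OF c2]])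
  have "fix_type (k + 2) # ?G2 \<turnstile> Var 2 \<Colon> arrow (Var (k + 2 + 4)) (fix_type (k + 2 + 1))"
    and "fix_type (k + 2) # ?G2 \<turnstile> Var 1 \<Colon> arrow (fix_type (k + 2 + 1)) (Var (k + 2 + 4))"
    by (rule var_of_type[OF w]; simp add: fix_type_def fix_eq_def eval_nat_numeral)+
  from fix_retraction_form[OF c2 this]
  have H: "?G2 \<turnstile> Pi (fix_type (k + 2)) (IdT (fix_type (k + 3)) (App (Var 2) (App (Var 1) (Var 0))) (Var 0)) \<Colon> Univ i"
    by (simp add: eval_nat_numeral)
  let ?G3 = "Pi (fix_type (k + 2)) (IdT (fix_type (k + 3)) (App (Var 2) (App (Var 1) (Var 0))) (Var 0)) # ?G2"
  have c3: "idem_ctx i (k + 3) ?G3"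
    using idem_ctx_ext[OF c2 H] by (simp add: eval_nat_numeral)
  have w: "wf_ctx (Var (k + 3 + 3) # ?G3)"
    by (rule idem_ctx_wf[OF ctx_carrier[OF c3]])
  have "Var (k + 3 + 3) # ?G3 \<turnstile> Var 3 \<Colon> arrow (Var (k + 3 + 4)) (fix_type (k + 4))"
    and "Var (k + 3 + 3) # ?G3 \<turnstile> Var 2 \<Colon> arrow (fix_type (k + 4)) (Var (k + 3 + 4))"
    by (rule var_of_type[OF w]; simp add: fix_type_def fix_eq_def eval_nat_numeral)+
  from factorization_form[OF c3 this]
  have "?G3 \<turnstile> Pi (Var (k + 6)) (IdT (Var (k + 7)) (App (Var 2) (App (Var 3) (Var 0)))
      (App (Var (k + 5)) (Var 0))) \<Colon> Univ i"
    by (simp add: eval_nat_numeral)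
  then show ?thesis by (intro sig_form S H)
qed

text \<open>The third family: A and r have been chosen, and s is the variable.\<close>

lemma splitting_family_form_retr:
  assumes \<Gamma>: "idem_ctx i k \<Gamma>"
  shows "arrow (fix_type k) (Var (k + 3)) # \<Gamma> \<turnstile>
    Sig (Pi (fix_type (k + 1)) (IdT (fix_type (k + 2)) (App (retr (k + 2)) (App (Var 1) (Var 0))) (Var 0)))
      (Pi (Var (k + 5)) (IdT (Var (k + 6)) (App (Var 2) (App (retr (k + 3)) (Var 0)))
        (App (Var (k + 4)) (Var 0)))) \<Colon> Univ i"
proof -
  let ?G1 = "arrow (fix_type k) (Var (k + 3)) # \<Gamma>"
  have c1: "idem_ctx i (k + 1) ?G1"
    by (rule ctx_arrow_fix_carrier[OF \<Gamma>])
  have c: "idem_ctx i (k + 1 + 1) (fix_type (k + 1) # ?G1)"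
    by (rule ctx_fix_type[OF c1])
  have r: "fix_type (k + 1) # ?G1 \<turnstile> retr (k + 2) \<Colon> arrow (Var (k + 1 + 4)) (fix_type (k + 1 + 1))"
    using retr_type[OF c] by (simp add: eval_nat_numeral)
  have "fix_type (k + 1) # ?G1 \<turnstile> Var 1 \<Colon> arrow (fix_type (k + 1 + 1)) (Var (k + 1 + 4))"
    by (rule var_of_type[OF idem_ctx_wf[OF c]]) (simp_all add: fix_type_def fix_eq_def eval_nat_numeral)
  from fix_retraction_form[OF c1 r this]
  have H: "?G1 \<turnstile> Pi (fix_type (k + 1)) (IdT (fix_type (k + 2)) (App (retr (k + 2)) (App (Var 1) (Var 0))) (Var 0)) \<Colon> Univ i"
    by (simp add: eval_nat_numeral)
  let ?G2 = "Pi (fix_type (k + 1)) (IdT (fix_type (k + 2)) (App (retr (k + 2)) (App (Var 1) (Var 0))) (Var 0)) # ?G1"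
  have c2: "idem_ctx i (k + 2) ?G2"
    using idem_ctx_ext[OF c1 H] by simp
  have c: "idem_ctx i (k + 2 + 1) (Var (k + 2 + 3) # ?G2)"
    by (rule ctx_carrier[OF c2])
  have r: "Var (k + 2 + 3) # ?G2 \<turnstile> retr (k + 3) \<Colon> arrow (Var (k + 2 + 4)) (fix_type (k + 3))"
    using retr_type[OF c] by (simp add: eval_nat_numeral)
  have "Var (k + 2 + 3) # ?G2 \<turnstile> Var 2 \<Colon> arrow (fix_type (k + 3)) (Var (k + 2 + 4))"
    by (rule var_of_type[OF idem_ctx_wf[OF c]]) (simp_all add: fix_type_def fix_eq_def eval_nat_numeral)
  from factorization_form[OF c2 r this]
  have "?G2 \<turnstile> Pi (Var (k + 5)) (IdT (Var (k + 6)) (App (Var 2) (App (retr (k + 3)) (Var 0)))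
        (App (Var (k + 4)) (Var 0))) \<Colon> Univ i"
    by (simp add: eval_nat_numeral)
  then show ?thesis by (intro sig_form H)
qed

lemma splitting_family_form_sect:
  assumes \<Gamma>: "idem_ctx i k \<Gamma>"
  shows "Pi (fix_type k) (IdT (fix_type (k + 1)) (App (retr (k + 1)) (App (sect (k + 1)) (Var 0))) (Var 0)) # \<Gamma> \<turnstile>
    Pi (Var (k + 4)) (IdT (Var (k + 5)) (App (sect (k + 2)) (App (retr (k + 2)) (Var 0)))
      (App (Var (k + 3)) (Var 0))) \<Colon> Univ i"
proof -
  let ?H = "Pi (fix_type k) (IdT (fix_type (k + 1)) (App (retr (k + 1)) (App (sect (k + 1)) (Var 0))) (Var 0))"
  have c: "idem_ctx i (k + 1) (fix_type k # \<Gamma>)"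
    by (rule ctx_fix_type[OF \<Gamma>])
  have "\<Gamma> \<turnstile> ?H \<Colon> Univ i"
    using retr_type[OF c] sect_type[OF c]
    by (intro fix_retraction_form[OF \<Gamma>]) (simp_all add: eval_nat_numeral)
  from idem_ctx_ext[OF \<Gamma> this] have c1: "idem_ctx i (k + 1) (?H # \<Gamma>)"
    by simp
  have c2: "idem_ctx i (k + 2) (Var (k + 1 + 3) # ?H # \<Gamma>)"
    using ctx_carrier[OF c1] by simp
  have "Var (k + 1 + 3) # ?H # \<Gamma> \<turnstile> retr (k + 2) \<Colon> arrow (Var (k + 1 + 4)) (fix_type (k + 2))"
    and "Var (k + 1 + 3) # ?H # \<Gamma> \<turnstile> sect (k + 2) \<Colon> arrow (fix_type (k + 2)) (Var (k + 1 + 4))"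
    using retr_type[OF c2] sect_type[OF c2] by (simp_all add: eval_nat_numeral)
  from factorization_form[OF c1 this] show ?thesis by (simp add: eval_nat_numeral)
qed

lemma idem_splitting:
  assumes \<Gamma>: "idem_ctx i k \<Gamma>"
  shows "\<exists>t. \<Gamma> \<turnstile> t \<Colon> splitting i (Var (k + 3)) (Var (k + 1))"
proof -
  obtain h where h: "\<Gamma> \<turnstile> h \<Colon> Pi (fix_type k)
      (IdT (fix_type (k + 1)) (App (retr (k + 1)) (App (sect (k + 1)) (Var 0))) (Var 0))"
    using retr_sect_path[OF \<Gamma>] by blast
  obtain e where e: "\<Gamma> \<turnstile> e \<Colon> Pi (Var (k + 3)) (IdT (Var (k + 4))
      (App (sect (k + 1)) (App (retr (k + 1)) (Var 0))) (App (Var (k + 2)) (Var 0)))"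
    using sect_retr_path[OF \<Gamma>] by blast
  \<comment> \<open>The pairs are built from the inside out. Each \<open>sig_intro\<close> leaves
    the goal that the type just obtained is the next family instantiated at the new component;
    unfolding the definitions exposes the indices for that comparison.\<close>
  have "\<Gamma> \<turnstile> Pr h e \<Colon> Sig
      (Pi (fix_type k) (IdT (fix_type (k + 1)) (App (retr (k + 1)) (App (sect (k + 1)) (Var 0))) (Var 0)))
      (Pi (Var (k + 4)) (IdT (Var (k + 5)) (App (sect (k + 2)) (App (retr (k + 2)) (Var 0)))
        (App (Var (k + 3)) (Var 0))))"
    using e by (intro sig_intro[OF splitting_family_form_sect[OF \<Gamma>] h])
      (simp add: retr_def sect_def fix_type_def fix_eq_def eval_nat_numeral)
  then have "\<Gamma> \<turnstile> Pr (sect k) (Pr h e) \<Colon> Sig (arrow (fix_type k) (Var (k + 3)))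
     (Sig (Pi (fix_type (k + 1)) (IdT (fix_type (k + 2)) (App (retr (k + 2)) (App (Var 1) (Var 0))) (Var 0)))
      (Pi (Var (k + 5)) (IdT (Var (k + 6)) (App (Var 2) (App (retr (k + 3)) (Var 0)))
        (App (Var (k + 4)) (Var 0)))))"
    by (intro sig_intro[OF splitting_family_form_retr[OF \<Gamma>] sect_type[OF \<Gamma>]])
      (simp add: retr_def sect_def fix_type_def fix_eq_def eval_nat_numeral)
  then have "\<Gamma> \<turnstile> Pr (retr k) (Pr (sect k) (Pr h e)) \<Colon> Sig (arrow (Var (k + 3)) (fix_type k))
     (Sig (arrow (fix_type (k + 1)) (Var (k + 4)))
      (Sig (Pi (fix_type (k + 2)) (IdT (fix_type (k + 3)) (App (Var 2) (App (Var 1) (Var 0))) (Var 0)))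
       (Pi (Var (k + 6)) (IdT (Var (k + 7)) (App (Var 2) (App (Var 3) (Var 0)))
         (App (Var (k + 5)) (Var 0))))))"
    by (intro sig_intro[OF splitting_family_form_fix[OF \<Gamma>] retr_type[OF \<Gamma>]])
      (simp add: retr_def fix_type_def fix_eq_def eval_nat_numeral)
  \<comment> \<open>A has to lie in \<open>Univ i\<close> itself. It does, because X and its
    identity types are at level \<open>i\<close>.\<close>
  then have "\<Gamma> \<turnstile> Pr (fix_type k) (Pr (retr k) (Pr (sect k) (Pr h e))) \<Colon> Sig (Univ i)
     (Sig (arrow (Var (k + 4)) (Var 0))
      (Sig (arrow (Var 1) (Var (k + 5)))
       (Sig (Pi (Var 2) (IdT (Var 3) (App (Var 2) (App (Var 1) (Var 0))) (Var 0)))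
         (Pi (Var (k + 7)) (IdT (Var (k + 8)) (App (Var 2) (App (Var 3) (Var 0)))
           (App (Var (k + 6)) (Var 0)))))))"
    by (intro sig_intro[OF splitting_family_form[OF \<Gamma>] fix_type_form[OF \<Gamma>]])
      (simp add: fix_type_def fix_eq_def eval_nat_numeral)
  then show ?thesis
    by (intro exI) (simp add: splitting_def eval_nat_numeral)
qed

section \<open>Well-formedness of the hypotheses\<close>

lemma is_set_form: "[Univ i] \<turnstile> is_set (Var 0) \<Colon> Univ i"
proof -
  let ?G1 = "[Var 0, Univ i]"
  let ?G2 = "Var 1 # ?G1"
  let ?G3 = "IdT (Var 2) (Var 1) (Var 0) # ?G2"
  let ?G4 = "IdT (Var 3) (Var 2) (Var 1) # ?G3"
  have w0: "wf_ctx [Univ i]"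
    by (rule ctx_ext[OF ctx_empty univ_intro[OF ctx_empty]])
  have X0: "[Univ i] \<turnstile> Var 0 \<Colon> Univ i"
    by (rule var_of_type[OF w0]) simp_all
  note w1 = ctx_ext[OF w0 X0]
  have X1: "?G1 \<turnstile> Var 1 \<Colon> Univ i"
    by (rule var_of_type[OF w1]) simp_all
  note w2 = ctx_ext[OF w1 X1]
  have P2: "?G2 \<turnstile> IdT (Var 2) (Var 1) (Var 0) \<Colon> Univ i"
    by (intro id_form var_of_type[OF w2]) (simp_all add: eval_nat_numeral)
  note w3 = ctx_ext[OF w2 P2]
  have P3: "?G3 \<turnstile> IdT (Var 3) (Var 2) (Var 1) \<Colon> Univ i"
    by (intro id_form var_of_type[OF w3]) (simp_all add: eval_nat_numeral)
  note w4 = ctx_ext[OF w3 P3]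
  have "?G4 \<turnstile> IdT (IdT (Var 4) (Var 3) (Var 2)) (Var 1) (Var 0) \<Colon> Univ i"
    by (intro id_form var_of_type[OF w4]) (simp_all add: eval_nat_numeral)
  then have "[Univ i] \<turnstile> Pi (Var 0) (Pi (Var 1) (Pi (IdT (Var 2) (Var 1) (Var 0))
      (Pi (IdT (Var 3) (Var 2) (Var 1)) (IdT (IdT (Var 4) (Var 3) (Var 2)) (Var 1) (Var 0))))) \<Colon> Univ i"
    by (intro pi_form X0 X1 P2 P3)
  then show ?thesis by (simp add: is_set_def eval_nat_numeral)
qed

text \<open>Depth 0 starts the bookkeeping. The entries are typed by hand, since lemmas such as
  \<open>carrier_type\<close> already presuppose \<open>idem_ctx\<close>.\<close>

lemma idem_ctx_hyps: "idem_ctx i 0 (hyps i)"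
proof -
  have w1: "wf_ctx [is_set (Var 0), Univ i]"
    by (rule ctx_ext[OF ctx_ext[OF ctx_empty univ_intro[OF ctx_empty]] is_set_form])
  have X1: "[is_set (Var 0), Univ i] \<turnstile> Var 1 \<Colon> Univ i"
    by (rule var_of_type[OF w1]) simp_all
  have "[Var 1, is_set (Var 0), Univ i] \<turnstile> Var 2 \<Colon> Univ i"
    by (rule var_of_type[OF ctx_ext[OF w1 X1]]) simp_all
  then have "[is_set (Var 0), Univ i] \<turnstile> arrow (Var 1) (Var 1) \<Colon> Univ i"
    by (intro arrow_form X1) (simp add: eval_nat_numeral)
  note w2 = ctx_ext[OF w1 this]
  let ?G = "[arrow (Var 1) (Var 1), is_set (Var 0), Univ i]"
  have X2: "?G \<turnstile> Var 2 \<Colon> Univ i"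
    by (rule var_of_type[OF w2]) simp_all
  note w3 = ctx_ext[OF w2 X2]
  have X3: "Var 2 # ?G \<turnstile> Var 3 \<Colon> Univ i" and x: "Var 2 # ?G \<turnstile> Var 0 \<Colon> Var 3"
    and f: "Var 2 # ?G \<turnstile> Var 1 \<Colon> arrow (Var 3) (Var 3)"
    by (rule var_of_type[OF w3]; simp add: eval_nat_numeral)+
  have "?G \<turnstile> Pi (Var 2) (IdT (Var 3) (App (Var 1) (App (Var 1) (Var 0))) (App (Var 1) (Var 0))) \<Colon> Univ i"
    by (intro pi_form id_form X2 X3 arrow_elim[OF f] x)
  then have "?G \<turnstile> idempotence (Var 2) (Var 0) \<Colon> Univ i"
    by (simp add: idempotence_def)
  from ctx_ext[OF w2 this] show ?thesis by (simp add: idem_ctx_def hyps_def)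
qed

theorem theorem3p7:
  fixes i :: nat
  shows "\<exists>t. [] \<turnstile> t \<Colon>
    Pi (Univ i)
     (Pi (is_set (Var 0))
       (Pi (arrow (Var 1) (Var 1))
         (Pi (idempotence (Var 2) (Var 0))
           (splitting i (Var 3) (Var 1)))))"
proof -
  obtain t where "hyps i \<turnstile> t \<Colon> splitting i (Var 3) (Var 1)"
    using idem_splitting[OF idem_ctx_hyps] by auto
  \<comment> \<open>Four uses of \<open>pi_intro\<close> discharge the hypotheses, the most recent
    first.\<close>
  then show ?thesis
    unfolding hyps_def by (blast intro: pi_intro)
qed

end
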